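(* If $\psi:\mathfrak{sv}^+\to\mathbb{C}$ is identically zero and $\xi=0$, then the submodule $V$ of $L_{\psi,0}$ generated by $L_{-2}\bar w$, where $\bar w=\overline{1\otimes1}$, is a maximal proper submodule. Moreover, $L_{\psi,0}/V$ is a one-dimensional trivial module.
   Context: The Schrödinger-Virasoro algebra $\mathfrak{sv}$ is the complex Lie algebra with basis $\{L_n,M_n,Y_{n+\frac12}\mid n\in\mathbb{Z}\}$ and brackets, for $m,n\in\mathbb{Z}$: $[L_m,L_n]=(n-m)L_{m+n}$, $[L_m,M_n]=nM_{m+n}$, $[L_m,Y_{n+\frac12}]=(n+\frac{1-m}{2})Y_{m+n+\frac12}$, $[Y_{m+\frac12},Y_{n+\frac12}]=(n-m)M_{m+n+1}$, $[M_m,M_n]=[M_m,Y_{n+\frac12}]=0$. The element $M_0$ is central. Put $\mathfrak{sv}^+=\mathrm{span}_{\mathbb{C}}\{L_n,M_n,Y_{m+\frac12}\mid n\geq 1,\ m\geq 0\}$. For a Lie algebra homomorphism $\psi:\mathfrak{sv}^+\to\mathbb{C}$ let $\mathbb{C}_\psi$ be the one-dimensional $\mathfrak{sv}^+$-module with $x\alpha=\psi(x)\alpha$, let $W_\psi=U(\mathfrak{sv})\otimes_{U(\mathfrak{sv}^+)}\mathbb{C}_\psi$, and for $\xi\in\mathbb{C}$ let $L_{\psi,\xi}=W_\psi/(M_0-\xi)W_\psi$; $\overline{1\otimes1}$ denotes the image of $1\otimes1$. *)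

theory Defs
  imports
    Complex_Main
    "HOL-Algebra.QuotRing"
    "HOL-Algebra.Free_Abelian_Groups"
begin

section \<open>Complex Lie algebras\<close>

class complex_lie_algebra = ab_group_add +
  fixes cscale :: "complex \<Rightarrow> 'a \<Rightarrow> 'a"
    and lie_bracket :: "'a \<Rightarrow> 'a \<Rightarrow> 'a"
  assumes cscale_add_right: "cscale a (x + y) = cscale a x + cscale a y"
    and cscale_add_left: "cscale (a + b) x = cscale a x + cscale b x"
    and cscale_cscale: "cscale a (cscale b x) = cscale (a * b) x"
    and cscale_one: "cscale 1 x = x"
    and bracket_add_left: "lie_bracket (x + y) z = lie_bracket x z + lie_bracket y z"
    and bracket_add_right: "lie_bracket x (y + z) = lie_bracket x y + lie_bracket x z"
    and bracket_cscale_left: "lie_bracket (cscale a x) y = cscale a (lie_bracket x y)"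
    and bracket_cscale_right: "lie_bracket x (cscale a y) = cscale a (lie_bracket x y)"
    and bracket_self: "lie_bracket x x = 0"
    and jacobi: "lie_bracket x (lie_bracket y z) + lie_bracket y (lie_bracket z x)
                  + lie_bracket z (lie_bracket x y) = 0"

global_interpretation clie: vector_space "cscale :: complex \<Rightarrow> 'a :: complex_lie_algebra \<Rightarrow> 'a"
  by unfold_locales
    (simp_all add: cscale_add_right cscale_add_left cscale_cscale cscale_one)

definition lie_character :: "'g :: complex_lie_algebra set \<Rightarrow> ('g \<Rightarrow> complex) \<Rightarrow> bool" where
  "lie_character h \<psi> \<longleftrightarrow>
     (\<forall>x\<in>h. \<forall>y\<in>h. \<psi> (x + y) = \<psi> x + \<psi> y) \<and>
     (\<forall>c. \<forall>x\<in>h. \<psi> (cscale c x) = c * \<psi> x) \<and>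
     (\<forall>x\<in>h. \<forall>y\<in>h. \<psi> (lie_bracket x y) = \<psi> x * \<psi> y - \<psi> y * \<psi> x)"


section \<open>The universal enveloping algebra\<close>

text \<open>Words over an alphabet, written additively because the monoid algebra of an additive
  monoid is what \<^theory>\<open>HOL-Library.Poly_Mapping\<close> provides.\<close>

datatype 'a word = Word (letters: "'a list")

instantiation word :: (type) monoid_add
begin

definition zero_word :: "'a word" where "zero_word = Word []"

definition plus_word :: "'a word \<Rightarrow> 'a word \<Rightarrow> 'a word" where
  "plus_word u v = Word (letters u @ letters v)"

instance
  by standard (simp_all add: zero_word_def plus_word_def)

end

definition free_alg :: "'g set \<Rightarrow> ('g word \<Rightarrow>\<^sub>0 complex) ring" where
  "free_alg h = \<lparr>carrier = {p. \<forall>w\<in>Poly_Mapping.keys p. set (letters w) \<subseteq> h},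
                 monoid.mult = (*), one = 1, ring.zero = 0, add = (+)\<rparr>"

definition free_scalar :: "complex \<Rightarrow> 'g word \<Rightarrow>\<^sub>0 complex" where
  "free_scalar c = Poly_Mapping.single (Word []) c"

definition free_gen :: "'g \<Rightarrow> 'g word \<Rightarrow>\<^sub>0 complex" where
  "free_gen x = Poly_Mapping.single (Word [x]) 1"

text \<open>The free algebra on the underlying set of \<open>h\<close> modulo the linearity relations is the
  tensor algebra of \<open>h\<close>; the commutator relations then cut out the enveloping algebra
  of the Lie subalgebra \<open>h\<close>.\<close>

definition uea_rels :: "'g :: complex_lie_algebra set \<Rightarrow> ('g word \<Rightarrow>\<^sub>0 complex) set" where
  "uea_rels h =
     {free_gen (cscale a x + cscale b y) - free_scalar a * free_gen x - free_scalar b * free_gen y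
        | a b x y. x \<in> h \<and> y \<in> h} \<union>
     {free_gen x * free_gen y - free_gen y * free_gen x - free_gen (lie_bracket x y)
        | x y. x \<in> h \<and> y \<in> h}"

definition uea_ideal :: "'g :: complex_lie_algebra set \<Rightarrow> ('g word \<Rightarrow>\<^sub>0 complex) set" where
  "uea_ideal h = genideal (free_alg h) (uea_rels h)"

definition uea :: "'g :: complex_lie_algebra set \<Rightarrow> ('g word \<Rightarrow>\<^sub>0 complex) set ring" where
  "uea h = free_alg h Quot uea_ideal h"

definition uea_class ::
    "'g :: complex_lie_algebra set \<Rightarrow> ('g word \<Rightarrow>\<^sub>0 complex) \<Rightarrow> ('g word \<Rightarrow>\<^sub>0 complex) set" where
  "uea_class h p = uea_ideal h +>\<^bsub>free_alg h\<^esub> p"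

text \<open>The algebra homomorphism from the enveloping algebra of \<open>h\<close> to that of the whole Lie
  algebra which extends the inclusion. A coset \<open>X\<close> of the smaller ideal lies in a single coset
  of the larger one, and the union below is that coset.\<close>

definition uea_incl ::
    "('g :: complex_lie_algebra word \<Rightarrow>\<^sub>0 complex) set \<Rightarrow> ('g word \<Rightarrow>\<^sub>0 complex) set" where
  "uea_incl X = (\<Union>p\<in>X. uea_class UNIV p)"


section \<open>Modules over a Lie algebra\<close>

text \<open>The additive group of a module is stored in the fields of \<^typ>\<open>'v monoid\<close>, hence is
  written multiplicatively, as in \<^const>\<open>free_Abelian_group\<close>.\<close>

record ('g, 'v) lie_mod = "'v monoid" +
  cmul :: "complex \<Rightarrow> 'v \<Rightarrow> 'v"
  act :: "'g \<Rightarrow> 'v \<Rightarrow> 'v"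

locale lie_module = comm_group M
  for h :: "'g :: complex_lie_algebra set" and M :: "('g, 'v) lie_mod" (structure) +
  assumes cmul_closed: "v \<in> carrier M \<Longrightarrow> cmul M c v \<in> carrier M"
    and cmul_add_right: "\<lbrakk>u \<in> carrier M; v \<in> carrier M\<rbrakk> \<Longrightarrow> cmul M c (u \<otimes> v) = cmul M c u \<otimes> cmul M c v"
    and cmul_add_left: "v \<in> carrier M \<Longrightarrow> cmul M (a + b) v = cmul M a v \<otimes> cmul M b v"
    and cmul_cmul: "v \<in> carrier M \<Longrightarrow> cmul M a (cmul M b v) = cmul M (a * b) v"
    and cmul_one: "v \<in> carrier M \<Longrightarrow> cmul M 1 v = v"
    and act_closed: "\<lbrakk>x \<in> h; v \<in> carrier M\<rbrakk> \<Longrightarrow> act M x v \<in> carrier M"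
    and act_add_right: "\<lbrakk>x \<in> h; u \<in> carrier M; v \<in> carrier M\<rbrakk> \<Longrightarrow> act M x (u \<otimes> v) = act M x u \<otimes> act M x v"
    and act_cmul: "\<lbrakk>x \<in> h; v \<in> carrier M\<rbrakk> \<Longrightarrow> act M x (cmul M c v) = cmul M c (act M x v)"
    and act_add_left: "\<lbrakk>x \<in> h; y \<in> h; v \<in> carrier M\<rbrakk> \<Longrightarrow> act M (x + y) v = act M x v \<otimes> act M y v"
    and act_cscale: "\<lbrakk>x \<in> h; v \<in> carrier M\<rbrakk> \<Longrightarrow> act M (cscale c x) v = cmul M c (act M x v)"
    and act_bracket: "\<lbrakk>x \<in> h; y \<in> h; v \<in> carrier M\<rbrakk> \<Longrightarrow>
          act M (lie_bracket x y) v = act M x (act M y v) \<otimes> inv (act M y (act M x v))"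

locale lie_submodule = lie_module h M + subgroup N M
  for h :: "'g :: complex_lie_algebra set" and N :: "'v set"
    and M :: "('g, 'v) lie_mod" (structure) +
  assumes sub_cmul_closed: "v \<in> N \<Longrightarrow> cmul M c v \<in> N"
    and sub_act_closed: "\<lbrakk>x \<in> h; v \<in> N\<rbrakk> \<Longrightarrow> act M x v \<in> N"

definition gen_submodule ::
    "'g :: complex_lie_algebra set \<Rightarrow> ('g, 'v) lie_mod \<Rightarrow> 'v set \<Rightarrow> 'v set" where
  "gen_submodule h M S = \<Inter>{N. lie_submodule h N M \<and> S \<subseteq> N}"

definition maximal_proper_submodule ::
    "'g :: complex_lie_algebra set \<Rightarrow> ('g, 'v) lie_mod \<Rightarrow> 'v set \<Rightarrow> bool" where
  "maximal_proper_submodule h M V \<longleftrightarrow>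
     lie_submodule h V M \<and> V \<noteq> carrier M \<and>
     (\<forall>N. lie_submodule h N M \<and> V \<subseteq> N \<longrightarrow> N = V \<or> N = carrier M)"

text \<open>For a submodule \<open>N\<close>, the set \<open>N <#> f ` X\<close> with \<open>X\<close> a coset of \<open>N\<close> and \<open>f\<close> an additive map
  preserving \<open>N\<close> is the coset of \<open>f v\<close> for any \<open>v \<in> X\<close>.\<close>

definition quot_module :: "('g, 'v) lie_mod \<Rightarrow> 'v set \<Rightarrow> ('g, 'v set) lie_mod" where
  "quot_module M N = monoid.extend (M Mod N)
     (lie_mod.fields (\<lambda>c X. N <#>\<^bsub>M\<^esub> (cmul M c ` X)) (\<lambda>x X. N <#>\<^bsub>M\<^esub> (act M x ` X)))"

definition one_dimensional_module ::
    "'g :: complex_lie_algebra set \<Rightarrow> ('g, 'v) lie_mod \<Rightarrow> bool" where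
  "one_dimensional_module h M \<longleftrightarrow> lie_module h M \<and>
     (\<exists>v\<in>carrier M. v \<noteq> \<one>\<^bsub>M\<^esub> \<and> carrier M = range (\<lambda>c. cmul M c v))"

definition trivial_module ::
    "'g :: complex_lie_algebra set \<Rightarrow> ('g, 'v) lie_mod \<Rightarrow> bool" where
  "trivial_module h M \<longleftrightarrow> lie_module h M \<and> (\<forall>x\<in>h. \<forall>v\<in>carrier M. act M x v = \<one>\<^bsub>M\<^esub>)"

definition character_module :: "('g \<Rightarrow> complex) \<Rightarrow> ('g, complex) lie_mod" where
  "character_module \<psi> = \<lparr>carrier = UNIV, monoid.mult = (+), one = 0,
                         cmul = (*), act = (\<lambda>x a. \<psi> x * a)\<rparr>"


section \<open>Induced modules\<close>

text \<open>The action of the free algebra on a Lie module, and the action of the enveloping algebra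
  it induces: on a module over the Lie subalgebra \<open>h\<close>, all elements of a coset of
  \<open>uea_ideal h\<close> act in the same way.\<close>

definition free_act :: "('g, 'v) lie_mod \<Rightarrow> ('g word \<Rightarrow>\<^sub>0 complex) \<Rightarrow> 'v \<Rightarrow> 'v" where
  "free_act M p v =
     finprod M (\<lambda>w. cmul M (Poly_Mapping.lookup p w) (foldr (act M) (letters w) v)) (Poly_Mapping.keys p)"

definition uea_act :: "('g, 'v) lie_mod \<Rightarrow> ('g word \<Rightarrow>\<^sub>0 complex) set \<Rightarrow> 'v \<Rightarrow> 'v" where
  "uea_act M X v = (THE u. \<exists>p\<in>X. u = free_act M p v)"

text \<open>The tensor product over \<open>R\<close> of a right \<open>R\<close>-module with additive group \<open>A\<close> and action \<open>ra\<close>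
  and a left \<open>R\<close>-module with additive group \<open>B\<close> and action \<open>la\<close>.\<close>

definition tensor_rels ::
    "('r, 'z) ring_scheme \<Rightarrow> ('a, 'x) monoid_scheme \<Rightarrow> ('a \<Rightarrow> 'r \<Rightarrow> 'a) \<Rightarrow>
     ('b, 'y) monoid_scheme \<Rightarrow> ('r \<Rightarrow> 'b \<Rightarrow> 'b) \<Rightarrow> ('a \<times> 'b \<Rightarrow>\<^sub>0 int) set" where
  "tensor_rels R A ra B la =
     {frag_of (a \<otimes>\<^bsub>A\<^esub> a', b) - frag_of (a, b) - frag_of (a', b)
        | a a' b. a \<in> carrier A \<and> a' \<in> carrier A \<and> b \<in> carrier B} \<union>
     {frag_of (a, b \<otimes>\<^bsub>B\<^esub> b') - frag_of (a, b) - frag_of (a, b')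
        | a b b'. a \<in> carrier A \<and> b \<in> carrier B \<and> b' \<in> carrier B} \<union>
     {frag_of (ra a r, b) - frag_of (a, la r b)
        | a r b. a \<in> carrier A \<and> r \<in> carrier R \<and> b \<in> carrier B}"

definition tensor_kernel ::
    "('r, 'z) ring_scheme \<Rightarrow> ('a, 'x) monoid_scheme \<Rightarrow> ('a \<Rightarrow> 'r \<Rightarrow> 'a) \<Rightarrow>
     ('b, 'y) monoid_scheme \<Rightarrow> ('r \<Rightarrow> 'b \<Rightarrow> 'b) \<Rightarrow> ('a \<times> 'b \<Rightarrow>\<^sub>0 int) set" where
  "tensor_kernel R A ra B la =
     generate (free_Abelian_group (carrier A \<times> carrier B)) (tensor_rels R A ra B la)"

text \<open>The subgroup defining \<open>U(g) \<otimes> N\<close> over \<open>U(h)\<close>, for the Lie subalgebra \<open>h\<close> of \<open>g = UNIV\<close>.\<close>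

definition induced_kernel ::
    "'g :: complex_lie_algebra set \<Rightarrow> ('g, 'v) lie_mod \<Rightarrow>
     (('g word \<Rightarrow>\<^sub>0 complex) set \<times> 'v \<Rightarrow>\<^sub>0 int) set" where
  "induced_kernel h N =
     tensor_kernel (uea h)
       (add_monoid (uea UNIV)) (\<lambda>u r. u \<otimes>\<^bsub>uea UNIV\<^esub> uea_incl r)
       N (uea_act N)"

definition induced_free ::
    "('g :: complex_lie_algebra, 'v) lie_mod \<Rightarrow> (('g word \<Rightarrow>\<^sub>0 complex) set \<times> 'v \<Rightarrow>\<^sub>0 int) monoid" where
  "induced_free N = free_Abelian_group (carrier (uea (UNIV :: 'g set)) \<times> carrier N)"

text \<open>Left multiplication by \<open>r\<close> on the first tensor factor, as an operation on cosets.\<close>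

definition induced_lmult ::
    "'g :: complex_lie_algebra set \<Rightarrow> ('g, 'v) lie_mod \<Rightarrow> ('g word \<Rightarrow>\<^sub>0 complex) set \<Rightarrow>
     (('g word \<Rightarrow>\<^sub>0 complex) set \<times> 'v \<Rightarrow>\<^sub>0 int) set \<Rightarrow>
     (('g word \<Rightarrow>\<^sub>0 complex) set \<times> 'v \<Rightarrow>\<^sub>0 int) set" where
  "induced_lmult h N r X = induced_kernel h N <#>\<^bsub>induced_free N\<^esub>
     (frag_extend (\<lambda>(u, v). frag_of (r \<otimes>\<^bsub>uea UNIV\<^esub> u, v)) ` X)"

definition induced_module ::
    "'g :: complex_lie_algebra set \<Rightarrow> ('g, 'v) lie_mod \<Rightarrow>
     ('g, (('g word \<Rightarrow>\<^sub>0 complex) set \<times> 'v \<Rightarrow>\<^sub>0 int) set) lie_mod" where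
  "induced_module h N = monoid.extend (induced_free N Mod induced_kernel h N)
     (lie_mod.fields
       (\<lambda>c. induced_lmult h N (uea_class UNIV (free_scalar c)))
       (\<lambda>x. induced_lmult h N (uea_class UNIV (free_gen x))))"

definition pure_tensor ::
    "'g :: complex_lie_algebra set \<Rightarrow> ('g, 'v) lie_mod \<Rightarrow> ('g word \<Rightarrow>\<^sub>0 complex) set \<Rightarrow> 'v \<Rightarrow>
     (('g word \<Rightarrow>\<^sub>0 complex) set \<times> 'v \<Rightarrow>\<^sub>0 int) set" where
  "pure_tensor h N u v = induced_kernel h N #>\<^bsub>induced_free N\<^esub> frag_of (u, v)"


section \<open>The Schroedinger-Virasoro algebra\<close>

text \<open>\<open>Idx_Y n\<close> is the index of the basis element \<open>Y\<close> with subscript \<open>n + 1/2\<close>.\<close>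

datatype sv_index = Idx_L int | Idx_M int | Idx_Y int

fun basis_bracket :: "sv_index \<Rightarrow> sv_index \<Rightarrow> sv_index \<Rightarrow>\<^sub>0 complex" where
  "basis_bracket (Idx_L m) (Idx_L n) = Poly_Mapping.single (Idx_L (m + n)) (of_int (n - m))"
| "basis_bracket (Idx_L m) (Idx_M n) = Poly_Mapping.single (Idx_M (m + n)) (of_int n)"
| "basis_bracket (Idx_L m) (Idx_Y n) =
     Poly_Mapping.single (Idx_Y (m + n)) (of_int n + (1 - of_int m) / 2)"
| "basis_bracket (Idx_Y m) (Idx_Y n) = Poly_Mapping.single (Idx_M (m + n + 1)) (of_int (n - m))"
| "basis_bracket (Idx_M m) (Idx_M n) = 0"
| "basis_bracket (Idx_M m) (Idx_Y n) = 0"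
| "basis_bracket (Idx_M m) (Idx_L n) = - Poly_Mapping.single (Idx_M (n + m)) (of_int m)"
| "basis_bracket (Idx_Y m) (Idx_L n) =
     - Poly_Mapping.single (Idx_Y (n + m)) (of_int m + (1 - of_int n) / 2)"
| "basis_bracket (Idx_Y m) (Idx_M n) = 0"

typedef sv = "UNIV :: (sv_index \<Rightarrow>\<^sub>0 complex) set"
  morphisms coords of_coords
  by simp

setup_lifting type_definition_sv

lift_definition sv_basis :: "sv_index \<Rightarrow> sv" is "\<lambda>i. Poly_Mapping.single i 1" .

definition pm_scale :: "complex \<Rightarrow> (sv_index \<Rightarrow>\<^sub>0 complex) \<Rightarrow> (sv_index \<Rightarrow>\<^sub>0 complex)" where
  "pm_scale c p = Poly_Mapping.map ((*) c) p"

definition pm_bracket ::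
    "(sv_index \<Rightarrow>\<^sub>0 complex) \<Rightarrow> (sv_index \<Rightarrow>\<^sub>0 complex) \<Rightarrow> (sv_index \<Rightarrow>\<^sub>0 complex)" where
  "pm_bracket p q = (\<Sum>i\<in>Poly_Mapping.keys p. \<Sum>j\<in>Poly_Mapping.keys q.
     pm_scale (Poly_Mapping.lookup p i * Poly_Mapping.lookup q j) (basis_bracket i j))"

lemma lookup_pm_scale [simp]: "Poly_Mapping.lookup (pm_scale c p) i = c * Poly_Mapping.lookup p i"
  by (simp add: pm_scale_def Poly_Mapping.map.rep_eq when_def)

lemma pm_scale_simps:
  "pm_scale a (p + q) = pm_scale a p + pm_scale a q"
  "pm_scale (a + b) p = pm_scale a p + pm_scale b p"
  "pm_scale a (pm_scale b p) = pm_scale (a * b) p"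
  "pm_scale 1 p = p"
  "pm_scale 0 p = 0"
  "pm_scale a 0 = 0"
  "pm_scale a (- p) = - pm_scale a p"
  "pm_scale a (Poly_Mapping.single i c) = Poly_Mapping.single i (a * c)"
  by (auto intro!: poly_mapping_eqI simp: lookup_add algebra_simps lookup_single when_def)

lemma pm_scale_sum: "pm_scale a (sum f A) = (\<Sum>x\<in>A. pm_scale a (f x))"
  by (induction A rule: infinite_finite_induct) (simp_all add: pm_scale_simps)

lemma pm_bracket_superset:
  assumes "finite A" "finite B" "Poly_Mapping.keys p \<subseteq> A" "Poly_Mapping.keys q \<subseteq> B"
  shows "pm_bracket p q = (\<Sum>i\<in>A. \<Sum>j\<in>B.
     pm_scale (Poly_Mapping.lookup p i * Poly_Mapping.lookup q j) (basis_bracket i j))"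
proof -
  have "pm_bracket p q = (\<Sum>i\<in>Poly_Mapping.keys p. \<Sum>j\<in>B.
     pm_scale (Poly_Mapping.lookup p i * Poly_Mapping.lookup q j) (basis_bracket i j))"
    unfolding pm_bracket_def
    using assms by (intro sum.cong refl sum.mono_neutral_left) (auto simp: in_keys_iff pm_scale_simps)
  also have "\<dots> = (\<Sum>i\<in>A. \<Sum>j\<in>B.
     pm_scale (Poly_Mapping.lookup p i * Poly_Mapping.lookup q j) (basis_bracket i j))"
    using assms by (intro sum.mono_neutral_left) (auto simp: in_keys_iff pm_scale_simps)
  finally show ?thesis .
qed

lemma pm_bracket_add_left: "pm_bracket (p + p') q = pm_bracket p q + pm_bracket p' q"
proof -
  let ?A = "Poly_Mapping.keys p \<union> Poly_Mapping.keys p'"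
  have *: "Poly_Mapping.keys (p + p') \<subseteq> ?A" by (rule keys_add)
  show ?thesis
    by (simp add: pm_bracket_superset [of ?A "Poly_Mapping.keys q"] * lookup_add ring_distribs
        pm_scale_simps sum.distrib)
qed

lemma pm_bracket_add_right: "pm_bracket q (p + p') = pm_bracket q p + pm_bracket q p'"
proof -
  let ?A = "Poly_Mapping.keys p \<union> Poly_Mapping.keys p'"
  have *: "Poly_Mapping.keys (p + p') \<subseteq> ?A" by (rule keys_add)
  show ?thesis
    by (simp add: pm_bracket_superset [of "Poly_Mapping.keys q" ?A] * lookup_add ring_distribs
        pm_scale_simps sum.distrib)
qed

lemma pm_bracket_scale_left: "pm_bracket (pm_scale a p) q = pm_scale a (pm_bracket p q)"
proof -
  have *: "Poly_Mapping.keys (pm_scale a p) \<subseteq> Poly_Mapping.keys p" by (auto simp: in_keys_iff)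
  show ?thesis
    by (simp add: pm_bracket_superset [of "Poly_Mapping.keys p" "Poly_Mapping.keys q"] *
        pm_scale_simps pm_scale_sum mult.assoc)
qed

lemma pm_bracket_scale_right: "pm_bracket p (pm_scale a q) = pm_scale a (pm_bracket p q)"
proof -
  have *: "Poly_Mapping.keys (pm_scale a q) \<subseteq> Poly_Mapping.keys q" by (auto simp: in_keys_iff)
  show ?thesis
    by (simp add: pm_bracket_superset [of "Poly_Mapping.keys p" "Poly_Mapping.keys q"] *
        pm_scale_simps pm_scale_sum mult.left_commute)
qed

lemma pm_bracket_zero [simp]: "pm_bracket 0 q = 0" "pm_bracket p 0 = 0"
  by (simp_all add: pm_bracket_def)

lemma pm_bracket_single:
  "pm_bracket (Poly_Mapping.single i a) (Poly_Mapping.single j b) = pm_scale (a * b) (basis_bracket i j)"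
  by (simp add: pm_bracket_superset [of "{i}" "{j}"])

lemma pm_bracket_uminus:
  "pm_bracket (- p) q = - pm_bracket p q" "pm_bracket p (- q) = - pm_bracket p q"
proof -
  show "pm_bracket (- p) q = - pm_bracket p q"
    using pm_bracket_add_left [of p "- p" q] by (simp add: eq_neg_iff_add_eq_0 add.commute)
  show "pm_bracket p (- q) = - pm_bracket p q"
    using pm_bracket_add_right [of p q "- q"] by (simp add: eq_neg_iff_add_eq_0 add.commute)
qed

lemma pm_induct:
  fixes p :: "sv_index \<Rightarrow>\<^sub>0 complex"
  assumes "P 0" "\<And>i c. P (Poly_Mapping.single i c)" "\<And>p q. P p \<Longrightarrow> P q \<Longrightarrow> P (p + q)"
  shows "P p"
proof (induction p rule: update_induct)
  case const
  then show ?case by (rule assms)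
next
  case (update p a b)
  have "Poly_Mapping.update a b p = Poly_Mapping.single a b + p"
    using update by (auto intro!: poly_mapping_eqI simp: lookup_add lookup_single lookup_update
        when_def in_keys_iff)
  then show ?case using update assms by simp
qed

lemma basis_bracket_swap: "basis_bracket i j = - basis_bracket j i"
  by (cases i; cases j) (auto intro!: poly_mapping_eqI simp: lookup_single when_def ac_simps)

lemma pm_bracket_swap: "pm_bracket p q = - pm_bracket q p"
proof (induction p rule: pm_induct)
  case (2 i c)
  show ?case
  proof (induction q rule: pm_induct)
    case (2 j d)
    then show ?case
      by (simp add: pm_bracket_single mult.commute basis_bracket_swap [of i j] pm_scale_simps)
  qed (simp_all add: pm_bracket_add_left pm_bracket_add_right)
qed (simp_all add: pm_bracket_add_left pm_bracket_add_right)

lemma pm_bracket_self: "pm_bracket p p = 0"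
proof (rule poly_mapping_eqI)
  fix k
  have "Poly_Mapping.lookup (pm_bracket p p) k = - Poly_Mapping.lookup (pm_bracket p p) k"
    using arg_cong [OF pm_bracket_swap [of p p], of "\<lambda>r. Poly_Mapping.lookup r k"] by simp
  then show "Poly_Mapping.lookup (pm_bracket p p) k = Poly_Mapping.lookup 0 k" by simp
qed

lemma pm_jacobi_single:
  "pm_bracket (Poly_Mapping.single i a) (pm_bracket (Poly_Mapping.single j b) (Poly_Mapping.single k c))
   + pm_bracket (Poly_Mapping.single j b) (pm_bracket (Poly_Mapping.single k c) (Poly_Mapping.single i a))
   + pm_bracket (Poly_Mapping.single k c) (pm_bracket (Poly_Mapping.single i a) (Poly_Mapping.single j b)) = 0"
  by (cases i; cases j; cases k;
      simp add: pm_bracket_single pm_scale_simps pm_bracket_uminus ac_simps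
        flip: single_add single_uminus single_diff;
      (simp add: field_simps)?)

lemma pm_jacobi: "pm_bracket p (pm_bracket q r) + pm_bracket q (pm_bracket r p)
                  + pm_bracket r (pm_bracket p q) = 0"
proof -
  define J where "J p q r = pm_bracket p (pm_bracket q r) + pm_bracket q (pm_bracket r p)
                  + pm_bracket r (pm_bracket p q)" for p q r
  have add: "J (p + p') q r = J p q r + J p' q r" "J p (q + q') r = J p q r + J p q' r"
    "J p q (r + r') = J p q r + J p q r'" for p p' q q' r r'
    by (simp_all add: J_def pm_bracket_add_left pm_bracket_add_right ac_simps)
  have zero: "J 0 q r = 0" "J p 0 r = 0" "J p q 0 = 0" for p q r
    by (simp_all add: J_def)
  have "J p q r = 0"
  proof (induction p rule: pm_induct)
    case (2 i a)
    show ?case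
    proof (induction q rule: pm_induct)
      case (2 j b)
      show ?case
      proof (induction r rule: pm_induct)
        case (2 k c)
        show ?case unfolding J_def by (rule pm_jacobi_single)
      qed (simp_all add: add zero)
    qed (simp_all add: add zero)
  qed (simp_all add: add zero)
  then show ?thesis by (simp only: J_def)
qed

instantiation sv :: complex_lie_algebra
begin

lift_definition zero_sv :: sv is 0 .
lift_definition plus_sv :: "sv \<Rightarrow> sv \<Rightarrow> sv" is "(+)" .
lift_definition minus_sv :: "sv \<Rightarrow> sv \<Rightarrow> sv" is "(-)" .
lift_definition uminus_sv :: "sv \<Rightarrow> sv" is uminus .
lift_definition cscale_sv :: "complex \<Rightarrow> sv \<Rightarrow> sv" is pm_scale .
lift_definition lie_bracket_sv :: "sv \<Rightarrow> sv \<Rightarrow> sv" is pm_bracket .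

instance
  by (standard; transfer)
    (rule pm_scale_simps pm_bracket_add_left pm_bracket_add_right pm_bracket_scale_left
      pm_bracket_scale_right pm_bracket_self pm_jacobi | simp add: ac_simps)+

end

text \<open>\<open>sv_Y n\<close> is the basis element \<open>Y\<close> with subscript \<open>n + 1/2\<close>.\<close>

abbreviation sv_L :: "int \<Rightarrow> sv" where "sv_L n \<equiv> sv_basis (Idx_L n)"
abbreviation sv_M :: "int \<Rightarrow> sv" where "sv_M n \<equiv> sv_basis (Idx_M n)"
abbreviation sv_Y :: "int \<Rightarrow> sv" where "sv_Y n \<equiv> sv_basis (Idx_Y n)"

lemma sv_brackets:
  "lie_bracket (sv_L m) (sv_L n) = cscale (of_int (n - m)) (sv_L (m + n))"
  "lie_bracket (sv_L m) (sv_M n) = cscale (of_int n) (sv_M (m + n))"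
  "lie_bracket (sv_L m) (sv_Y n) = cscale (of_int n + (1 - of_int m) / 2) (sv_Y (m + n))"
  "lie_bracket (sv_Y m) (sv_Y n) = cscale (of_int (n - m)) (sv_M (m + n + 1))"
  "lie_bracket (sv_M m) (sv_M n) = 0"
  "lie_bracket (sv_M m) (sv_Y n) = 0"
  by (transfer; simp add: pm_bracket_single pm_scale_simps)+

definition sv_plus :: "sv set" where
  "sv_plus = clie.span ({sv_L n | n. n \<ge> 1} \<union> {sv_M n | n. n \<ge> 1} \<union> {sv_Y m | m. m \<ge> 0})"

type_synonym w_space = "((sv word \<Rightarrow>\<^sub>0 complex) set \<times> complex \<Rightarrow>\<^sub>0 int) set"

definition W_mod :: "(sv \<Rightarrow> complex) \<Rightarrow> (sv, w_space) lie_mod" where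
  "W_mod \<psi> = induced_module sv_plus (character_module \<psi>)"

text \<open>The submodule \<open>(M\<^sub>0 - \<xi>) W\<close>.\<close>

definition M0_image :: "(sv \<Rightarrow> complex) \<Rightarrow> complex \<Rightarrow> w_space set" where
  "M0_image \<psi> \<xi> = (\<lambda>w. act (W_mod \<psi>) (sv_M 0) w \<otimes>\<^bsub>W_mod \<psi>\<^esub> cmul (W_mod \<psi>) (- \<xi>) w)
                      ` carrier (W_mod \<psi>)"

definition L_mod :: "(sv \<Rightarrow> complex) \<Rightarrow> complex \<Rightarrow> (sv, w_space set) lie_mod" where
  "L_mod \<psi> \<xi> = quot_module (W_mod \<psi>) (M0_image \<psi> \<xi>)"

definition w_bar :: "(sv \<Rightarrow> complex) \<Rightarrow> complex \<Rightarrow> w_space set" where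
  "w_bar \<psi> \<xi> = M0_image \<psi> \<xi> #>\<^bsub>W_mod \<psi>\<^esub>
      pure_tensor sv_plus (character_module \<psi>) \<one>\<^bsub>uea UNIV\<^esub> 1"

end

theory Submission
  imports Defs
begin

text \<open>Write \<open>w\<close> for the generator of \<open>L\<^bsub>\<psi>,0\<^esub>\<close>, the class of \<open>1 \<otimes> 1\<close>. Since \<open>\<psi>\<close> is zero, all of \<open>sv_plus\<close>
  kills \<open>w\<close>. The elements \<open>x\<close> of the Lie algebra with \<open>x w \<in> V\<close> form a Lie subalgebra
  (\<open>lie_subalgebra_transporter\<close>), which contains \<open>sv_plus\<close> and, by the choice of \<open>V\<close>, also \<open>L\<^sub>-\<^sub>2\<close>. These
  generate the whole Lie algebra (\<open>sv_generated\<close>), so it maps \<open>w\<close> into \<open>V\<close>. As \<open>w\<close> generates the module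
  (\<open>vac_generates\<close>), the sum of \<open>V\<close> and the line through \<open>w\<close> is everything.

  It remains to see that \<open>w\<close> is not in \<open>V\<close>. For the zero character the augmentation of the enveloping
  algebra induces a homomorphism from \<open>W\<^sub>\<psi>\<close> onto the trivial module which sends \<open>1 \<otimes> 1\<close> to 1. Its kernel
  (\<open>augmentation_submodule\<close>) contains every \<open>x v\<close> with \<open>x\<close> in the Lie algebra, in particular the image of
  \<open>M\<^sub>0\<close> and \<open>L\<^sub>-\<^sub>2 (1 \<otimes> 1)\<close>. So \<open>V\<close> is a proper submodule of codimension one, and maximality, the dimension
  of the quotient and its triviality are formal consequences (\<open>codimension_one_submodule\<close>).

  The rest makes the constructions usable: quotients of modules, the enveloping algebra as a
  quotient of the free algebra, and the induced module as a quotient of formal sums of pairs.\<close>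

section \<open>Quotients of modules\<close>

text \<open>The operations of a quotient module are given on a coset \<open>X\<close> by \<open>N <#> f ` X\<close>; on a
  representative this is just \<open>f\<close>.\<close>

lemma (in comm_group) image_coset:
  assumes N: "subgroup N G" and f: "f \<in> hom G G" and fN: "\<And>n. n \<in> N \<Longrightarrow> f n \<in> N"
    and v: "v \<in> carrier G"
  shows "N <#> f ` (N #> v) = N #> f v"
proof -
  interpret N: subgroup N G by (rule N)
  have fG: "f u \<in> carrier G" if "u \<in> carrier G" for u
    using f that by (auto simp: hom_def)
  have "n \<otimes> f (n' \<otimes> v) = n \<otimes> f n' \<otimes> f v" if "n \<in> N" "n' \<in> N" for n n'
    using that v fG by (simp add: hom_mult [OF f] m_assoc N.mem_carrier)
  moreover have "n \<otimes> f v = n \<otimes> f (\<one> \<otimes> v)" for n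
    using v by simp
  ultimately show ?thesis
    unfolding set_mult_def r_coset_def
    by (fastforce intro: N.m_closed fN)
qed

text \<open>For a quotient by \<open>N\<close> to be a module, the module axioms only have to hold modulo \<open>N\<close>. Two
  kinds of quotient are of this form: that of a module by a submodule, and the induced module,
  which is the quotient of a free abelian group on which elements of the Lie algebra operate, but
  where this operation is additive in the Lie algebra element only up to the tensor relations.\<close>

locale lie_module_modulo = comm_group M + subgroup N M
  for N :: "'v set" and M :: "('g :: complex_lie_algebra, 'v) lie_mod" (structure) +
  assumes cmul_hom: "cmul M c \<in> hom M M"
    and act_hom: "act M x \<in> hom M M"
    and N_cmul: "v \<in> N \<Longrightarrow> cmul M c v \<in> N"
    and N_act: "v \<in> N \<Longrightarrow> act M x v \<in> N"
    and mod_cmul_add_left: "v \<in> carrier M \<Longrightarrow> N #> cmul M (a + b) v = N #> (cmul M a v \<otimes> cmul M b v)"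
    and mod_cmul_cmul: "v \<in> carrier M \<Longrightarrow> N #> cmul M a (cmul M b v) = N #> cmul M (a * b) v"
    and mod_cmul_one: "v \<in> carrier M \<Longrightarrow> N #> cmul M 1 v = N #> v"
    and mod_act_cmul: "v \<in> carrier M \<Longrightarrow> N #> act M x (cmul M c v) = N #> cmul M c (act M x v)"
    and mod_act_add_left: "v \<in> carrier M \<Longrightarrow>
          N #> act M (x + y) v = N #> (act M x v \<otimes> act M y v)"
    and mod_act_cscale: "v \<in> carrier M \<Longrightarrow> N #> act M (cscale c x) v = N #> cmul M c (act M x v)"
    and mod_act_bracket: "v \<in> carrier M \<Longrightarrow>
          N #> act M (lie_bracket x y) v = N #> (act M x (act M y v) \<otimes> inv (act M y (act M x v)))"
begin

lemma normal_N: "N \<lhd> M"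
  by (simp add: subgroup_imp_normal subgroup_axioms)

lemma ops_closed:
  "v \<in> carrier M \<Longrightarrow> cmul M c v \<in> carrier M"
  "v \<in> carrier M \<Longrightarrow> act M x v \<in> carrier M"
  using hom_in_carrier [OF cmul_hom] hom_in_carrier [OF act_hom] by auto

lemma quot_carrier: "carrier (quot_module M N) = (\<lambda>v. N #> v) ` carrier M"
  by (simp add: quot_module_def monoid.defs carrier_FactGroup)

lemma quot_one: "\<one>\<^bsub>quot_module M N\<^esub> = N"
  by (simp add: quot_module_def monoid.defs)

lemma quot_mult:
  "\<lbrakk>u \<in> carrier M; v \<in> carrier M\<rbrakk> \<Longrightarrow> (N #> u) \<otimes>\<^bsub>quot_module M N\<^esub> (N #> v) = N #> (u \<otimes> v)"
  using normal.rcos_sum [OF normal_N] by (simp add: quot_module_def monoid.defs)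

lemma quot_cmul: "v \<in> carrier M \<Longrightarrow> cmul (quot_module M N) c (N #> v) = N #> cmul M c v"
  using image_coset [OF subgroup_axioms cmul_hom N_cmul]
  by (simp add: quot_module_def monoid.defs lie_mod.defs)

lemma quot_act: "v \<in> carrier M \<Longrightarrow> act (quot_module M N) x (N #> v) = N #> act M x v"
  using image_coset [OF subgroup_axioms act_hom N_act]
  by (simp add: quot_module_def monoid.defs lie_mod.defs)

lemma coset_eq_one_iff: "v \<in> carrier M \<Longrightarrow> N #> v = N \<longleftrightarrow> v \<in> N"
  using coset_join1 [of N v] coset_join2 [of v N] subgroup_axioms subset by auto

lemma coset_eq_iff:
  assumes "u \<in> carrier M" "v \<in> carrier M"
  shows "N #> u = N #> v \<longleftrightarrow> u \<otimes> inv v \<in> N"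
proof
  assume "N #> u = N #> v"
  then have "u \<in> N #> v" using rcos_self [of u N] assms subgroup_axioms by simp
  then show "u \<otimes> inv v \<in> N" using rcos_module [OF is_group, of v u] assms by simp
next
  assume "u \<otimes> inv v \<in> N"
  then have "u \<in> N #> v" using rcos_module [OF is_group, of v u] assms by simp
  then show "N #> u = N #> v" using repr_independence [of u N v] assms subgroup_axioms by simp
qed

lemma quot_comm_group: "comm_group (quot_module M N)"
proof -
  interpret Q: comm_group "M Mod N"
    by (rule abelian_FactGroup [OF subgroup_axioms])
  have *: "carrier (quot_module M N) = carrier (M Mod N)" "mult (quot_module M N) = mult (M Mod N)"
    "\<one>\<^bsub>quot_module M N\<^esub> = \<one>\<^bsub>M Mod N\<^esub>"
    by (simp_all add: quot_module_def monoid.defs)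
  show ?thesis
    by (rule comm_groupI; simp only: *)
      (fact Q.m_closed Q.one_closed Q.m_assoc Q.m_comm Q.l_one Q.l_inv_ex)+
qed

lemma quot_inv: "v \<in> carrier M \<Longrightarrow> inv\<^bsub>quot_module M N\<^esub> (N #> v) = N #> inv v"
  by (intro group.inv_equality comm_group.axioms(2) quot_comm_group)
    (simp_all add: quot_mult quot_one quot_carrier coset_mult_one subset)

lemma quot_lie_module: "lie_module UNIV (quot_module M N)"
  by (intro lie_module.intro quot_comm_group lie_module_axioms.intro)
   (auto simp: quot_carrier quot_mult quot_cmul quot_act quot_inv ops_closed
      hom_mult [OF cmul_hom] hom_mult [OF act_hom]
      mod_cmul_add_left mod_cmul_cmul mod_cmul_one mod_act_cmul mod_act_add_left
      mod_act_cscale mod_act_bracket)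

lemma image_submodule:
  assumes "subgroup P M" and cP: "\<And>c v. v \<in> P \<Longrightarrow> cmul M c v \<in> P"
    and aP: "\<And>x v. v \<in> P \<Longrightarrow> act M x v \<in> P"
  shows "lie_submodule UNIV ((\<lambda>v. N #> v) ` P) (quot_module M N)"
proof -
  interpret P: subgroup P M by (rule assms)
  interpret Q: lie_module UNIV "quot_module M N" by (rule quot_lie_module)
  let ?I = "(\<lambda>v. N #> v) ` P"
  have "subgroup ?I (quot_module M N)"
  proof
    show "?I \<subseteq> carrier (quot_module M N)"
      using P.subset by (auto simp: quot_carrier)
    show "\<one>\<^bsub>quot_module M N\<^esub> \<in> ?I"
      by (simp add: coset_eq_one_iff [THEN iffD2] quot_one image_iff
          bexI [OF _ P.one_closed])
    show "X \<otimes>\<^bsub>quot_module M N\<^esub> Y \<in> ?I" if "X \<in> ?I" "Y \<in> ?I" for X Y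
      using that by (elim imageE) (simp add: quot_mult P.mem_carrier P.m_closed)
    show "inv\<^bsub>quot_module M N\<^esub> X \<in> ?I" if "X \<in> ?I" for X
      using that by (elim imageE) (simp add: quot_inv P.mem_carrier P.m_inv_closed)
  qed
  moreover have "cmul (quot_module M N) c X \<in> ?I" if "X \<in> ?I" for c X
    using that by (elim imageE) (simp add: quot_cmul P.mem_carrier cP)
  moreover have "act (quot_module M N) x X \<in> ?I" if "X \<in> ?I" for x X
    using that by (elim imageE) (simp add: quot_act P.mem_carrier aP)
  ultimately show ?thesis
    by (simp add: lie_submodule_def lie_submodule_axioms_def Q.lie_module_axioms)
qed

end

lemma (in lie_module) cmul_zero: "v \<in> carrier M \<Longrightarrow> cmul M 0 v = \<one>"
  using cmul_add_left [of v 0 0] cmul_closed [of v 0] by simp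

lemma (in lie_module) cmul_in_hom: "cmul M c \<in> hom M M"
  by (auto simp: hom_def cmul_closed cmul_add_right)

lemma (in lie_module) act_in_hom: "x \<in> h \<Longrightarrow> act M x \<in> hom M M"
  by (auto simp: hom_def act_closed act_add_right)

lemma lie_submodule_imp_modulo:
  assumes "lie_submodule UNIV N M"
  shows "lie_module_modulo N M"
proof -
  interpret lie_submodule UNIV N M by (rule assms)
  show ?thesis
    by unfold_locales (auto simp: cmul_in_hom act_in_hom sub_cmul_closed sub_act_closed cmul_add_left cmul_cmul
      cmul_one act_cmul act_add_left act_cscale act_bracket)
qed

lemma preimage_submodule:
  assumes N: "lie_submodule UNIV N M" and P: "lie_submodule UNIV P (quot_module M N)"
  shows "lie_submodule UNIV {v \<in> carrier M. N #>\<^bsub>M\<^esub> v \<in> P} M"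
proof -
  interpret lie_submodule UNIV N M by (rule N)
  interpret mm: lie_module_modulo N M by (rule lie_submodule_imp_modulo [OF N])
  interpret P: lie_submodule UNIV P "quot_module M N" by (rule P)
  show ?thesis
  proof (intro lie_submodule.intro lie_module_axioms lie_submodule_axioms.intro subgroup.intro)
    show "\<one>\<^bsub>M\<^esub> \<in> {v \<in> carrier M. N #>\<^bsub>M\<^esub> v \<in> P}"
      using P.one_closed by (simp add: mm.quot_one coset_mult_one subset)
  qed (use P.m_closed P.m_inv_closed P.sub_cmul_closed P.sub_act_closed in
      \<open>auto simp: cmul_closed act_closed simp flip: mm.quot_mult mm.quot_inv mm.quot_cmul mm.quot_act\<close>)
qed

lemma lie_submodule_gen_submodule:
  assumes M: "lie_module h M" and S: "S \<subseteq> carrier M"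
  shows "lie_submodule h (gen_submodule h M S) M"
proof -
  interpret lie_module h M by (rule M)
  have "lie_submodule h (carrier M) M"
    by (intro lie_submodule.intro M lie_submodule_axioms.intro subgroup_self)
      (simp_all add: cmul_closed act_closed)
  then have top: "carrier M \<in> {N. lie_submodule h N M \<and> S \<subseteq> N}"
    using S by simp
  have "subgroup (gen_submodule h M S) M"
    unfolding gen_submodule_def
    using top by (intro subgroups_Inter) (auto simp: lie_submodule_def)
  moreover have "cmul M c v \<in> gen_submodule h M S" if "v \<in> gen_submodule h M S" for c v
    using that by (auto simp: gen_submodule_def lie_submodule.sub_cmul_closed)
  moreover have "act M x v \<in> gen_submodule h M S" if "x \<in> h" "v \<in> gen_submodule h M S" for x v
    using that by (auto simp: gen_submodule_def lie_submodule.sub_act_closed)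
  ultimately show ?thesis
    by (simp add: lie_submodule_def lie_submodule_axioms_def lie_module_axioms)
qed

lemma gen_submodule_superset: "S \<subseteq> gen_submodule h M S"
  by (auto simp: gen_submodule_def)

lemma gen_submodule_least: "lie_submodule h N M \<Longrightarrow> S \<subseteq> N \<Longrightarrow> gen_submodule h M S \<subseteq> N"
  by (auto simp: gen_submodule_def)

section \<open>The enveloping algebra\<close>

lemma free_alg_simps [simp]:
  "monoid.mult (free_alg h) = (*)" "\<one>\<^bsub>free_alg h\<^esub> = 1" "\<zero>\<^bsub>free_alg h\<^esub> = 0"
  "add (free_alg h) = (+)"
  by (simp_all add: free_alg_def)

lemma free_alg_carrier:
  "p \<in> carrier (free_alg h) \<longleftrightarrow> (\<forall>w\<in>Poly_Mapping.keys p. set (letters w) \<subseteq> h)"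
  by (simp add: free_alg_def)

lemma free_alg_UNIV [simp]: "carrier (free_alg UNIV) = UNIV"
  by (auto simp: free_alg_carrier)

lemma free_alg_closed:
  assumes "p \<in> carrier (free_alg h)" "q \<in> carrier (free_alg h)"
  shows "p + q \<in> carrier (free_alg h)" "p - q \<in> carrier (free_alg h)" "p * q \<in> carrier (free_alg h)"
proof -
  show "p + q \<in> carrier (free_alg h)"
    using assms keys_add [of p q] by (force simp: free_alg_carrier)
  show "p - q \<in> carrier (free_alg h)"
    using assms keys_diff [of p q] by (force simp: free_alg_carrier)
  show "p * q \<in> carrier (free_alg h)"
    unfolding free_alg_carrier
  proof
    fix w assume "w \<in> Poly_Mapping.keys (p * q)"
    then obtain u v where "u \<in> Poly_Mapping.keys p" "v \<in> Poly_Mapping.keys q" "w = u + v"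
      using keys_mult [of p q] by auto
    with assms show "set (letters w) \<subseteq> h"
      by (auto simp: free_alg_carrier plus_word_def)
  qed
qed

lemma free_alg_const_closed:
  "0 \<in> carrier (free_alg h)" "1 \<in> carrier (free_alg h)" "free_scalar c \<in> carrier (free_alg h)"
  "x \<in> h \<Longrightarrow> free_gen x \<in> carrier (free_alg h)"
  by (auto simp: free_alg_carrier free_scalar_def free_gen_def single_one [symmetric] zero_word_def
      simp del: single_one)

lemma free_scalar_one: "free_scalar 1 = 1"
  by (simp add: free_scalar_def flip: zero_word_def)

lemma free_scalar_add: "free_scalar (a + b) = free_scalar a + free_scalar b"
  by (simp add: free_scalar_def single_add)

lemma free_scalar_mult: "free_scalar (a * b) = free_scalar a * free_scalar b"
  by (simp add: free_scalar_def mult_single plus_word_def)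

lemma free_scalar_zero: "free_scalar 0 = 0"
  by (simp add: free_scalar_def)

lemma free_gen_scalar: "free_gen x * free_scalar c = free_scalar c * free_gen x"
  by (simp add: free_scalar_def free_gen_def mult_single plus_word_def)

lemma free_alg_induct [case_names scalar gen add]:
  assumes scalar: "\<And>c. P (free_scalar c)"
    and gen: "\<And>x p. P p \<Longrightarrow> P (free_gen x * p)"
    and add: "\<And>p q. P p \<Longrightarrow> P q \<Longrightarrow> P (p + q)"
  shows "P p"
proof (induction p rule: update_induct)
  case const
  then show ?case using scalar [of 0] by (simp add: free_scalar_zero)
next
  case (update p w c)
  have "P (Poly_Mapping.single (Word xs) c)" for xs
  proof (induction xs)
    case Nil
    then show ?case using scalar [of c] by (simp add: free_scalar_def)
  next
    case (Cons x xs)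
    then show ?case
      using gen [of _ x] by (force simp: free_gen_def mult_single plus_word_def)
  qed
  then have "P (Poly_Mapping.single w c)" by (cases w) simp
  moreover have "Poly_Mapping.update w c p = Poly_Mapping.single w c + p"
    using update by (auto intro!: poly_mapping_eqI simp: lookup_add lookup_single lookup_update
        when_def in_keys_iff)
  ultimately show ?case using update add by simp
qed

lemma ring_free_alg: "ring (free_alg h)"
proof (rule ringI)
  show "abelian_group (free_alg h)"
  proof (rule abelian_groupI)
    show "\<exists>q\<in>carrier (free_alg h). q \<oplus>\<^bsub>free_alg h\<^esub> p = \<zero>\<^bsub>free_alg h\<^esub>"
      if "p \<in> carrier (free_alg h)" for p
      using that free_alg_closed(2) [OF free_alg_const_closed(1) that]
      by (intro bexI [of _ "0 - p"]) auto
  qed (auto simp: free_alg_closed free_alg_const_closed ac_simps)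
  show "Group.monoid (free_alg h)"
    by (rule monoidI) (auto simp: free_alg_closed free_alg_const_closed mult.assoc)
qed (auto simp: ring_distribs)

definition lie_subalgebra :: "'g :: complex_lie_algebra set \<Rightarrow> bool" where
  "lie_subalgebra h \<longleftrightarrow> clie.subspace h \<and> (\<forall>x\<in>h. \<forall>y\<in>h. lie_bracket x y \<in> h)"

lemma lie_subalgebra_UNIV: "lie_subalgebra UNIV"
  by (simp add: lie_subalgebra_def)

lemma uea_rels_subset: "lie_subalgebra h \<Longrightarrow> uea_rels h \<subseteq> carrier (free_alg h)"
  by (auto simp: uea_rels_def lie_subalgebra_def clie.subspace_add clie.subspace_scale
      intro!: free_alg_closed free_alg_const_closed)

lemma ideal_uea_ideal: "lie_subalgebra h \<Longrightarrow> ideal (uea_ideal h) (free_alg h)"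
  unfolding uea_ideal_def by (intro ring.genideal_ideal ring_free_alg uea_rels_subset)

lemma uea_rels_in_ideal: "lie_subalgebra h \<Longrightarrow> uea_rels h \<subseteq> uea_ideal h"
  unfolding uea_ideal_def by (intro ring.genideal_self ring_free_alg uea_rels_subset)

text \<open>Here \<open>J\<close> is an ideal of the free algebra on all of the Lie algebra. Its intersection with the free
  algebra on \<open>h\<close> is an ideal there, so membership in \<open>uea_ideal h\<close> can be tested in the larger algebra
  for every \<open>h\<close> at once.\<close>

lemma uea_ideal_least:
  assumes h: "lie_subalgebra h" and rels: "uea_rels h \<subseteq> J"
    and zero: "0 \<in> J" and add: "\<And>p q. p \<in> J \<Longrightarrow> q \<in> J \<Longrightarrow> p + q \<in> J"
    and mult: "\<And>p q. q \<in> J \<Longrightarrow> p * q \<in> J" "\<And>p q. q \<in> J \<Longrightarrow> q * p \<in> J"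
  shows "uea_ideal h \<subseteq> J"
proof -
  interpret R: ring "free_alg h" by (rule ring_free_alg)
  let ?J = "J \<inter> carrier (free_alg h)"
  have inv: "\<ominus>\<^bsub>free_alg h\<^esub> p = - p" if "p \<in> carrier (free_alg h)" for p
    using free_alg_closed(2) [OF free_alg_const_closed(1) that]
    by (intro R.minus_equality) (simp_all add: that)
  have "ideal ?J (free_alg h)"
  proof (rule idealI [OF ring_free_alg])
    show "subgroup ?J (add_monoid (free_alg h))"
    proof (rule R.add.subgroupI)
      show "?J \<noteq> {}"
        using zero free_alg_const_closed(1) [of h] by auto
      show "\<ominus>\<^bsub>free_alg h\<^esub> p \<in> ?J" if "p \<in> ?J" for p
        using that mult(1) [of p "- 1"] R.a_inv_closed [of p] by (simp add: inv)
      show "p \<oplus>\<^bsub>free_alg h\<^esub> q \<in> ?J" if "p \<in> ?J" "q \<in> ?J" for p q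
        using that R.a_closed [of p q] by (simp add: add)
    qed blast
    show "p \<otimes>\<^bsub>free_alg h\<^esub> q \<in> ?J" "q \<otimes>\<^bsub>free_alg h\<^esub> p \<in> ?J"
      if "q \<in> ?J" "p \<in> carrier (free_alg h)" for p q
      using that R.m_closed [of p q] R.m_closed [of q p] by (simp_all add: mult)
  qed
  then have "uea_ideal h \<subseteq> ?J"
    unfolding uea_ideal_def using rels uea_rels_subset [OF h] by (intro R.genideal_minimal) auto
  then show ?thesis by simp
qed

lemma uea_ideal_mono:
  assumes h: "lie_subalgebra h"
  shows "uea_ideal h \<subseteq> uea_ideal UNIV"
proof -
  interpret I: ideal "uea_ideal UNIV" "free_alg UNIV"
    by (rule ideal_uea_ideal [OF lie_subalgebra_UNIV])
  have "uea_rels h \<subseteq> uea_rels UNIV" by (auto simp: uea_rels_def)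
  then show ?thesis
    using uea_rels_in_ideal [OF lie_subalgebra_UNIV] I.I_l_closed I.I_r_closed
      additive_subgroup.zero_closed [OF I.additive_subgroup_axioms]
      additive_subgroup.a_closed [OF I.additive_subgroup_axioms]
    by (intro uea_ideal_least [OF h]) auto
qed

lemma ring_uea: "lie_subalgebra h \<Longrightarrow> ring (uea h)"
  unfolding uea_def by (intro ideal.quotient_is_ring ideal_uea_ideal)

lemma uea_carrier: "carrier (uea h) = uea_class h ` carrier (free_alg h)"
  by (auto simp: uea_def uea_class_def FactRing_def A_RCOSETS_def')

lemma uea_class_hom: "lie_subalgebra h \<Longrightarrow> uea_class h \<in> ring_hom (free_alg h) (uea h)"
  unfolding uea_def using ideal.rcos_ring_hom [OF ideal_uea_ideal, of h]
  by (simp add: uea_class_def [abs_def])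

lemma uea_class_eqI:
  assumes h: "lie_subalgebra h" and "p \<in> carrier (free_alg h)" "q \<in> carrier (free_alg h)"
    and "p - q \<in> uea_ideal h"
  shows "uea_class h p = uea_class h q"
proof -
  interpret I: ideal "uea_ideal h" "free_alg h" by (rule ideal_uea_ideal [OF h])
  have "p \<in> uea_ideal h +>\<^bsub>free_alg h\<^esub> q"
    using assms(4) by (force simp: a_r_coset_def')
  then show ?thesis
    unfolding uea_class_def using assms
    by (metis I.a_repr_independence' )
qed

lemma uea_class_self: "lie_subalgebra h \<Longrightarrow> p \<in> carrier (free_alg h) \<Longrightarrow> p \<in> uea_class h p"
  unfolding uea_class_def by (intro abelian_subgroup.a_rcos_self abelian_subgroupI3
   ideal.axioms ideal_uea_ideal ring.is_abelian_group ring_free_alg)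

text \<open>The union of cosets that defines \<open>uea_incl\<close> is a single coset, because the ideal for \<open>h\<close> is contained
  in the ideal for the whole Lie algebra.\<close>

lemma uea_incl_class:
  assumes h: "lie_subalgebra h" and "p \<in> carrier (free_alg h)"
  shows "uea_incl (uea_class h p) = uea_class UNIV p"
proof -
  have "uea_class UNIV q = uea_class UNIV p" if "q \<in> uea_class h p" for q
    using that uea_ideal_mono [OF h]
    by (intro uea_class_eqI lie_subalgebra_UNIV) (auto simp: uea_class_def a_r_coset_def')
  moreover have "p \<in> uea_class h p" using uea_class_self assms .
  ultimately show ?thesis
    unfolding uea_incl_def by blast
qed

lemma uea_class_simps:
  fixes p q :: "'g :: complex_lie_algebra word \<Rightarrow>\<^sub>0 complex"
  shows "uea_class UNIV p \<otimes>\<^bsub>uea UNIV\<^esub> uea_class UNIV q = uea_class UNIV (p * q)"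
    and "uea_class UNIV p \<oplus>\<^bsub>uea UNIV\<^esub> uea_class UNIV q = uea_class UNIV (p + q)"
    and "uea_class (UNIV :: 'g set) 1 = \<one>\<^bsub>uea UNIV\<^esub>"
  using ring_hom_mult [OF uea_class_hom [OF lie_subalgebra_UNIV], of p q]
    ring_hom_add [OF uea_class_hom [OF lie_subalgebra_UNIV], of p q]
    ring_hom_one [OF uea_class_hom [OF lie_subalgebra_UNIV]] by simp_all

lemma uea_class_linear:
  "uea_class UNIV (free_gen (cscale a x + cscale b y))
     = uea_class UNIV (free_scalar a * free_gen x + free_scalar b * free_gen y)"
proof (intro uea_class_eqI lie_subalgebra_UNIV)
  have "free_gen (cscale a x + cscale b y) - free_scalar a * free_gen x - free_scalar b * free_gen y
      \<in> uea_rels UNIV"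
    unfolding uea_rels_def by blast
  then show "free_gen (cscale a x + cscale b y) - (free_scalar a * free_gen x + free_scalar b * free_gen y)
      \<in> uea_ideal UNIV"
    using uea_rels_in_ideal [OF lie_subalgebra_UNIV] by (auto simp only: diff_diff_add)
qed simp_all

lemma uea_class_bracket:
  "uea_class UNIV (free_gen x * free_gen y)
     = uea_class UNIV (free_gen (lie_bracket x y) + free_gen y * free_gen x)"
proof (intro uea_class_eqI lie_subalgebra_UNIV)
  have "free_gen x * free_gen y - free_gen y * free_gen x - free_gen (lie_bracket x y) \<in> uea_rels UNIV"
    unfolding uea_rels_def by blast
  then show "free_gen x * free_gen y - (free_gen (lie_bracket x y) + free_gen y * free_gen x)
      \<in> uea_ideal UNIV"
    using uea_rels_in_ideal [OF lie_subalgebra_UNIV] by (auto simp only: diff_diff_add add.commute)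
qed simp_all

section \<open>Induced modules\<close>

text \<open>The two closure conditions on \<open>N\<close> ensure that the tensor relations lie in the free abelian group on
  \<open>U(g) \<times> N\<close>.\<close>

locale induction_data =
  fixes h :: "'g :: complex_lie_algebra set" and N :: "('g, 'v) lie_mod"
  assumes subalg: "lie_subalgebra h"
    and N_mult: "\<lbrakk>b \<in> carrier N; b' \<in> carrier N\<rbrakk> \<Longrightarrow> b \<otimes>\<^bsub>N\<^esub> b' \<in> carrier N"
    and N_uea_act: "\<lbrakk>X \<in> carrier (uea h); b \<in> carrier N\<rbrakk> \<Longrightarrow> uea_act N X b \<in> carrier N"
begin

abbreviation U :: "('g word \<Rightarrow>\<^sub>0 complex) set ring" where "U \<equiv> uea UNIV"
abbreviation F where "F \<equiv> induced_free N"
abbreviation K where "K \<equiv> induced_kernel h N"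
abbreviation cl :: "('g word \<Rightarrow>\<^sub>0 complex) \<Rightarrow> ('g word \<Rightarrow>\<^sub>0 complex) set" where "cl \<equiv> uea_class UNIV"

definition rels where
  "rels = tensor_rels (uea h) (add_monoid U) (\<lambda>u r. u \<otimes>\<^bsub>U\<^esub> uea_incl r) N (uea_act N)"

definition lmult :: "('g word \<Rightarrow>\<^sub>0 complex) set \<Rightarrow>
    (('g word \<Rightarrow>\<^sub>0 complex) set \<times> 'v \<Rightarrow>\<^sub>0 int) \<Rightarrow> (('g word \<Rightarrow>\<^sub>0 complex) set \<times> 'v \<Rightarrow>\<^sub>0 int)" where
  "lmult r = frag_extend (\<lambda>(u, v). frag_of (r \<otimes>\<^bsub>U\<^esub> u, v))"

text \<open>The structure on formal sums of pairs of which the induced module is the quotient by the tensor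
  relations.\<close>

definition pre_module where
  "pre_module = monoid.extend F
     (lie_mod.fields (\<lambda>c. lmult (cl (free_scalar c))) (\<lambda>x. lmult (cl (free_gen x))))"

sublocale U: ring "uea (UNIV :: 'g set)"
  by (rule ring_uea [OF lie_subalgebra_UNIV])

lemma cl_closed [simp]: "cl p \<in> carrier U"
  by (simp add: uea_carrier)

lemma F_simps [simp]:
  "X \<in> carrier F \<longleftrightarrow> Poly_Mapping.keys X \<subseteq> carrier U \<times> carrier N"
  "monoid.mult F = (+)" "\<one>\<^bsub>F\<^esub> = 0"
  by (simp_all add: induced_free_def) (simp add: free_Abelian_group_def)

lemma F_inv: "X \<in> carrier F \<Longrightarrow> inv\<^bsub>F\<^esub> X = - X"
  by (simp add: induced_free_def)

lemma incl_closed: "r \<in> carrier (uea h) \<Longrightarrow> uea_incl r \<in> carrier U"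
  using uea_incl_class [OF subalg] by (auto simp: uea_carrier)

lemma rels_cases [consumes 1, case_names add_left add_right balanced]:
  assumes "X \<in> rels"
  obtains u u' b where "u \<in> carrier U" "u' \<in> carrier U" "b \<in> carrier N"
      "X = frag_of (u \<oplus>\<^bsub>U\<^esub> u', b) - frag_of (u, b) - frag_of (u', b)"
  | u b b' where "u \<in> carrier U" "b \<in> carrier N" "b' \<in> carrier N"
      "X = frag_of (u, b \<otimes>\<^bsub>N\<^esub> b') - frag_of (u, b) - frag_of (u, b')"
  | u r b where "u \<in> carrier U" "r \<in> carrier (uea h)" "b \<in> carrier N"
      "X = frag_of (u \<otimes>\<^bsub>U\<^esub> uea_incl r, b) - frag_of (u, uea_act N r b)"
  using assms unfolding rels_def tensor_rels_def
proof (elim UnE CollectE exE conjE, goal_cases)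
  case (1 u u' b) then show ?case using that(1) [of u u' b] by simp
next
  case (2 u b b') then show ?case using that(2) [of u b b'] by simp
next
  case (3 u r b) then show ?case using that(3) [of u r b] by simp
qed

lemma rels_intros:
  "\<lbrakk>u \<in> carrier U; u' \<in> carrier U; b \<in> carrier N\<rbrakk> \<Longrightarrow>
     frag_of (u \<oplus>\<^bsub>U\<^esub> u', b) - frag_of (u, b) - frag_of (u', b) \<in> rels"
  "\<lbrakk>u \<in> carrier U; b \<in> carrier N; b' \<in> carrier N\<rbrakk> \<Longrightarrow>
     frag_of (u, b \<otimes>\<^bsub>N\<^esub> b') - frag_of (u, b) - frag_of (u, b') \<in> rels"
  "\<lbrakk>u \<in> carrier U; r \<in> carrier (uea h); b \<in> carrier N\<rbrakk> \<Longrightarrow>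
     frag_of (u \<otimes>\<^bsub>U\<^esub> uea_incl r, b) - frag_of (u, uea_act N r b) \<in> rels"
  unfolding rels_def tensor_rels_def monoid.select_convs partial_object.select_convs
    apply (rule UnI1, rule UnI1, intro CollectI exI conjI, rule refl; assumption)
   apply (rule UnI1, rule UnI2, intro CollectI exI conjI, rule refl; assumption)
  apply (rule UnI2, intro CollectI exI conjI, rule refl; assumption)
  done

lemma F_add: "X \<in> carrier F \<Longrightarrow> Y \<in> carrier F \<Longrightarrow> X + Y \<in> carrier F"
  using keys_add [of X Y] by auto

lemma F_diff: "X \<in> carrier F \<Longrightarrow> Y \<in> carrier F \<Longrightarrow> X - Y \<in> carrier F"
  using keys_diff [of X Y] by auto

lemma rels_subset: "rels \<subseteq> carrier F"
proof
  fix X assume "X \<in> rels"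
  then show "X \<in> carrier F"
  proof (cases rule: rels_cases)
    case (add_left u u' b)
    then show ?thesis by (simp only:) (intro F_diff; simp)
  next
    case (add_right u b b')
    then show ?thesis by (simp only:) (intro F_diff; simp add: N_mult)
  next
    case (balanced u r b)
    then show ?thesis by (simp only:) (intro F_diff; simp add: N_uea_act incl_closed)
  qed
qed

lemma K_eq: "K = generate F rels"
  by (simp add: induced_kernel_def tensor_kernel_def induced_free_def rels_def)

lemma F_comm_group: "comm_group F"
  by (simp add: induced_free_def abelian_free_Abelian_group)

lemma K_subgroup: "subgroup K F"
  unfolding K_eq
  by (intro group.generate_is_subgroup comm_group.axioms(2) F_comm_group rels_subset)

lemma K_add: "X \<in> K \<Longrightarrow> Y \<in> K \<Longrightarrow> X + Y \<in> K"
  using subgroup.m_closed [OF K_subgroup] by simp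

lemma K_uminus: "X \<in> K \<Longrightarrow> - X \<in> K"
  using subgroup.m_inv_closed [OF K_subgroup, of X] subgroup.mem_carrier [OF K_subgroup, of X]
  by (simp only: F_inv)

lemma K_zero: "0 \<in> K"
  using subgroup.one_closed [OF K_subgroup] by simp

lemma K_diff: "X \<in> K \<Longrightarrow> Y \<in> K \<Longrightarrow> X - Y \<in> K"
  using K_add [of X "- Y"] K_uminus [of Y] by simp

lemma K_rels: "X \<in> rels \<Longrightarrow> X \<in> K"
  unfolding K_eq by (rule generate.incl)

lemma lmult_simps [simp]:
  "lmult r 0 = 0" "lmult r (frag_of (u, b)) = frag_of (r \<otimes>\<^bsub>U\<^esub> u, b)"
  "lmult r (X - Y) = lmult r X - lmult r Y" "lmult r (X + Y) = lmult r X + lmult r Y"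
  "lmult r (- X) = - lmult r X"
  by (simp_all add: lmult_def frag_extend_diff frag_extend_add frag_extend_minus)

lemma lmult_closed: "r \<in> carrier U \<Longrightarrow> X \<in> carrier F \<Longrightarrow> lmult r X \<in> carrier F"
  unfolding lmult_def F_simps
  by (rule order_trans [OF keys_frag_extend]) auto

lemma lmult_K:
  assumes r: "r \<in> carrier U" and "X \<in> K"
  shows "lmult r X \<in> K"
proof -
  have rel: "lmult r X \<in> K" if "X \<in> rels" for X
  proof (rule K_rels)
    from that show "lmult r X \<in> rels"
    proof (cases rule: rels_cases)
      case (add_left u u' b)
      then show ?thesis
        using r rels_intros(1) [of "r \<otimes>\<^bsub>U\<^esub> u" "r \<otimes>\<^bsub>U\<^esub> u'" b] by (simp add: U.r_distr)
    next
      case (add_right u b b')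
      then show ?thesis
        using r by (simp add: rels_intros)
    next
      case (balanced u s b)
      then show ?thesis
        using r incl_closed [of s] by (simp add: rels_intros flip: U.m_assoc)
    qed
  qed
  show ?thesis
    using assms(2) unfolding K_eq
  proof (induction rule: generate.induct)
    case (inv X)
    then show ?case using rel [OF inv] rels_subset K_uminus by (auto simp: F_inv K_eq)
  qed (use rel K_add K_zero in \<open>auto simp: K_eq\<close>)
qed

text \<open>On a generator \<open>(u, b)\<close> the difference is the tensor relation for additivity in the first factor;
  additivity in \<open>r\<close> is the only property of \<open>lmult\<close> that needs the relations.\<close>

lemma lmult_add_left:
  assumes r: "r \<in> carrier U" "s \<in> carrier U" and X: "X \<in> carrier F"
  shows "lmult (r \<oplus>\<^bsub>U\<^esub> s) X - lmult r X - lmult s X \<in> K"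
proof -
  have "Poly_Mapping.keys X \<subseteq> carrier U \<times> carrier N" using X by simp
  then show ?thesis
  proof (induction X rule: frag_induction)
    case (one x)
    then obtain u b where "x = (u, b)" "u \<in> carrier U" "b \<in> carrier N" by auto
    then show ?case
      using r rels_intros(1) [of "r \<otimes>\<^bsub>U\<^esub> u" "s \<otimes>\<^bsub>U\<^esub> u" b] by (simp add: U.l_distr K_rels)
  next
    case (diff X Y)
    then show ?case
      using K_diff [of "lmult (r \<oplus>\<^bsub>U\<^esub> s) X - lmult r X - lmult s X"
          "lmult (r \<oplus>\<^bsub>U\<^esub> s) Y - lmult r Y - lmult s Y"] by (simp add: algebra_simps)
  qed (simp add: K_zero)
qed

lemma lmult_mult:
  assumes r: "r \<in> carrier U" "s \<in> carrier U" and X: "X \<in> carrier F"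
  shows "lmult (r \<otimes>\<^bsub>U\<^esub> s) X = lmult r (lmult s X)"
proof -
  have "Poly_Mapping.keys X \<subseteq> carrier U \<times> carrier N" using X by simp
  then show ?thesis
    by (induction X rule: frag_induction) (use r in \<open>auto simp: U.m_assoc\<close>)
qed

lemma lmult_one:
  assumes X: "X \<in> carrier F"
  shows "lmult \<one>\<^bsub>U\<^esub> X = X"
proof -
  have "Poly_Mapping.keys X \<subseteq> carrier U \<times> carrier N" using X by simp
  then show ?thesis
    by (induction X rule: frag_induction) auto
qed

lemma pre_module_simps [simp]:
  "carrier pre_module = carrier F" "monoid.mult pre_module = (+)" "\<one>\<^bsub>pre_module\<^esub> = 0"
  "cmul pre_module c = lmult (cl (free_scalar c))" "act pre_module x = lmult (cl (free_gen x))"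
  by (simp_all add: pre_module_def monoid.defs lie_mod.defs)

lemma induced_module_eq: "induced_module h N = quot_module pre_module K"
proof -
  have "set_mult pre_module = set_mult F" "r_coset pre_module = r_coset F"
    by (intro ext; simp add: set_mult_def r_coset_def)+
  then show ?thesis
    by (simp add: induced_module_def quot_module_def induced_lmult_def [abs_def] monoid.defs
        lie_mod.defs FactGroup_def RCOSETS_def lmult_def)
qed

lemma pre_r_coset: "K #>\<^bsub>pre_module\<^esub> X = K #>\<^bsub>F\<^esub> X"
  by (simp add: r_coset_def)

lemma pre_comm_group: "comm_group pre_module"
proof -
  interpret F: comm_group F by (rule F_comm_group)
  have *: "carrier pre_module = carrier F" "mult pre_module = mult F" "\<one>\<^bsub>pre_module\<^esub> = \<one>\<^bsub>F\<^esub>"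
    by simp_all
  show ?thesis
    by (rule comm_groupI; simp only: *)
      (fact F.m_closed F.one_closed F.m_assoc F.m_comm F.l_one F.l_inv_ex)+
qed

lemma pre_inv: "X \<in> carrier F \<Longrightarrow> inv\<^bsub>pre_module\<^esub> X = - X"
  by (intro group.inv_equality comm_group.axioms(2) pre_comm_group) simp_all

lemma K_subgroup_pre: "subgroup K pre_module"
proof -
  interpret P: comm_group pre_module by (rule pre_comm_group)
  show ?thesis
    using K_zero K_add K_uminus subgroup.subset [OF K_subgroup] subgroup.mem_carrier [OF K_subgroup]
    by (intro P.subgroupI) (auto simp del: F_simps simp: pre_inv)
qed

lemma coset_eqI:
  assumes "X \<in> carrier F" "Y \<in> carrier F" "X - Y \<in> K"
  shows "K #>\<^bsub>pre_module\<^esub> X = K #>\<^bsub>pre_module\<^esub> Y"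
proof -
  have "X \<in> K #>\<^bsub>pre_module\<^esub> Y"
    using assms(3) by (auto simp: r_coset_def intro!: bexI [of _ "X - Y"])
  then show ?thesis
    using group.repr_independence [OF comm_group.axioms(2) [OF pre_comm_group], of X K Y] assms
      K_subgroup_pre by simp
qed

lemma lie_module_modulo_pre: "lie_module_modulo K pre_module"
proof -
  note [simp del] = F_simps(1)
  have hom: "lmult r \<in> hom pre_module pre_module" if "r \<in> carrier U" for r
    using that by (auto simp: hom_def lmult_closed)
  have sum: "K #>\<^bsub>pre_module\<^esub> lmult (cl (p + q)) X = K #>\<^bsub>pre_module\<^esub> (lmult (cl p) X + lmult (cl q) X)"
    if "X \<in> carrier F" for p q X
    using lmult_add_left [of "cl p" "cl q" X] that
    by (intro coset_eqI lmult_closed F_add) (simp_all add: uea_class_simps diff_diff_add)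
  have prod: "lmult (cl p) (lmult (cl q) X) = lmult (cl (p * q)) X" if "X \<in> carrier F" for p q X
    using that by (simp add: lmult_mult [symmetric] uea_class_simps)
  show ?thesis
  proof (intro lie_module_modulo.intro lie_module_modulo_axioms.intro pre_comm_group K_subgroup_pre)
    fix x y :: 'g and X assume "X \<in> carrier pre_module"
    then have X: "X \<in> carrier F" by simp
    have "cl (free_gen (x + y)) = cl (free_gen x + free_gen y)"
      using uea_class_linear [of 1 x 1 y] by (simp add: cscale_one free_scalar_one)
    then show "K #>\<^bsub>pre_module\<^esub> act pre_module (x + y) X
        = K #>\<^bsub>pre_module\<^esub> (act pre_module x X \<otimes>\<^bsub>pre_module\<^esub> act pre_module y X)"
      by (simp add: sum X)
    have "K #>\<^bsub>pre_module\<^esub> lmult (cl (free_gen (lie_bracket x y))) X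
        = K #>\<^bsub>pre_module\<^esub> (lmult (cl (free_gen x * free_gen y)) X - lmult (cl (free_gen y * free_gen x)) X)"
      using K_uminus [OF lmult_add_left [of "cl (free_gen (lie_bracket x y))"
            "cl (free_gen y * free_gen x)" X]] X
      by (intro coset_eqI lmult_closed F_diff)
        (simp_all add: uea_class_simps uea_class_bracket [of x y] algebra_simps)
    then show "K #>\<^bsub>pre_module\<^esub> act pre_module (lie_bracket x y) X
        = K #>\<^bsub>pre_module\<^esub> (act pre_module x (act pre_module y X)
            \<otimes>\<^bsub>pre_module\<^esub> inv\<^bsub>pre_module\<^esub> (act pre_module y (act pre_module x X)))"
      using X by (simp add: prod pre_inv lmult_closed)
  next
    fix x :: 'g and c X assume "X \<in> carrier pre_module"
    then have X: "X \<in> carrier F" by simp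
    have "cl (free_gen (cscale c x)) = cl (free_scalar c * free_gen x)"
      using uea_class_linear [of c x 0 x] by (simp add: free_scalar_zero)
    then show "K #>\<^bsub>pre_module\<^esub> act pre_module (cscale c x) X
        = K #>\<^bsub>pre_module\<^esub> cmul pre_module c (act pre_module x X)"
      by (simp add: prod X)
    show "K #>\<^bsub>pre_module\<^esub> act pre_module x (cmul pre_module c X)
        = K #>\<^bsub>pre_module\<^esub> cmul pre_module c (act pre_module x X)"
      by (simp add: prod X free_gen_scalar)
  qed (simp_all add: hom lmult_K sum prod free_scalar_add free_scalar_mult free_scalar_one
      uea_class_simps lmult_one)
qed

sublocale pre: lie_module_modulo K pre_module
  by (rule lie_module_modulo_pre)

lemma induced_lie_module: "lie_module UNIV (induced_module h N)"
  unfolding induced_module_eq by (rule pre.quot_lie_module)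

lemma pure_tensor_eq: "pure_tensor h N u b = K #>\<^bsub>pre_module\<^esub> frag_of (u, b)"
  by (simp add: pure_tensor_def pre_r_coset)

lemma pure_tensor_closed:
  "u \<in> carrier U \<Longrightarrow> b \<in> carrier N \<Longrightarrow> pure_tensor h N u b \<in> carrier (induced_module h N)"
  by (simp add: pure_tensor_eq induced_module_eq pre.quot_carrier)

lemma act_pure_tensor:
  "u \<in> carrier U \<Longrightarrow> b \<in> carrier N \<Longrightarrow>
   act (induced_module h N) x (pure_tensor h N u b) = pure_tensor h N (cl (free_gen x) \<otimes>\<^bsub>U\<^esub> u) b"
  by (simp add: pure_tensor_eq induced_module_eq pre.quot_act)

lemma cmul_pure_tensor:
  "u \<in> carrier U \<Longrightarrow> b \<in> carrier N \<Longrightarrow>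
   cmul (induced_module h N) c (pure_tensor h N u b) = pure_tensor h N (cl (free_scalar c) \<otimes>\<^bsub>U\<^esub> u) b"
  by (simp add: pure_tensor_eq induced_module_eq pre.quot_cmul)

lemma pure_tensor_add_left:
  assumes "u \<in> carrier U" "u' \<in> carrier U" "b \<in> carrier N"
  shows "pure_tensor h N (u \<oplus>\<^bsub>U\<^esub> u') b
     = pure_tensor h N u b \<otimes>\<^bsub>induced_module h N\<^esub> pure_tensor h N u' b"
proof -
  have "K #>\<^bsub>pre_module\<^esub> frag_of (u \<oplus>\<^bsub>U\<^esub> u', b)
      = K #>\<^bsub>pre_module\<^esub> (frag_of (u, b) + frag_of (u', b))"
    using assms
    by (intro coset_eqI F_add K_rels) (simp_all add: rels_intros N_mult flip: diff_diff_add)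
  then show ?thesis
    using assms by (simp add: pure_tensor_eq induced_module_eq pre.quot_mult)
qed

lemma pure_tensor_balanced:
  assumes "u \<in> carrier U" "p \<in> carrier (free_alg h)" "b \<in> carrier N"
  shows "pure_tensor h N (u \<otimes>\<^bsub>U\<^esub> cl p) b = pure_tensor h N u (uea_act N (uea_class h p) b)"
proof -
  have p: "uea_class h p \<in> carrier (uea h)"
    using assms by (simp add: uea_carrier)
  have "frag_of (u \<otimes>\<^bsub>U\<^esub> cl p, b) - frag_of (u, uea_act N (uea_class h p) b) \<in> rels"
    using rels_intros(3) [OF assms(1) p assms(3)] by (simp add: uea_incl_class [OF subalg assms(2)])
  then show ?thesis
    unfolding pure_tensor_eq using assms N_uea_act [OF p]
    by (intro coset_eqI K_rels) auto
qed

text \<open>A pure tensor \<open>p \<otimes> b\<close> is obtained from \<open>1 \<otimes> b\<close> by scalars, the action of Lie algebra elements and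
  addition, by induction on the element \<open>p\<close> of the free algebra; and pure tensors generate the tensor
  product additively.\<close>

lemma induced_module_generated:
  assumes P: "lie_submodule UNIV P (induced_module h N)"
    and gen: "\<And>b. b \<in> carrier N \<Longrightarrow> pure_tensor h N \<one>\<^bsub>U\<^esub> b \<in> P"
  shows "P = carrier (induced_module h N)"
proof
  interpret P: lie_submodule UNIV P "induced_module h N" by (rule P)
  show "P \<subseteq> carrier (induced_module h N)" by (rule P.subset)
  have pure: "pure_tensor h N (cl p) b \<in> P" if b: "b \<in> carrier N" for p b
  proof (induction p rule: free_alg_induct)
    case (scalar c)
    then show ?case
      using P.sub_cmul_closed [OF gen [OF b], of c] b by (simp add: cmul_pure_tensor)
  next
    case (gen x p)
    then show ?case
      using P.sub_act_closed [of x] b by (force simp: act_pure_tensor uea_class_simps)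
  next
    case (add p q)
    then show ?case
      using P.m_closed b by (force simp: pure_tensor_add_left simp flip: uea_class_simps)
  qed
  have "K #>\<^bsub>pre_module\<^esub> X \<in> P" if "Poly_Mapping.keys X \<subseteq> carrier U \<times> carrier N" for X
    using that
  proof (induction X rule: free_Abelian_group_induct [consumes 1, case_names zero diff one])
    case zero
    then show ?case
      using P.one_closed pre.coset_eq_one_iff [of 0] K_zero by (simp add: induced_module_eq pre.quot_one)
  next
    case (diff X Y)
    have "K #>\<^bsub>pre_module\<^esub> (X - Y)
        = (K #>\<^bsub>pre_module\<^esub> X) \<otimes>\<^bsub>induced_module h N\<^esub> inv\<^bsub>induced_module h N\<^esub> (K #>\<^bsub>pre_module\<^esub> Y)"
      using diff(1,2) by (simp add: induced_module_eq pre.quot_inv pre.quot_mult pre_inv)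
    then show ?case using diff(3,4) by simp
  next
    case (one a)
    then obtain u b where "a = (u, b)" "u \<in> carrier U" "b \<in> carrier N" by auto
    then show ?case
      using pure [of b] by (auto simp: pure_tensor_eq uea_carrier)
  qed
  then show "carrier (induced_module h N) \<subseteq> P"
    by (auto simp: induced_module_eq pre.quot_carrier)
qed

end

section \<open>The augmentation\<close>

text \<open>The constant coefficient, an algebra homomorphism that annihilates the Lie algebra. It is the
  augmentation on the free algebra, and it descends to enveloping algebras.\<close>

definition counit :: "('g word \<Rightarrow>\<^sub>0 complex) \<Rightarrow> complex" where
  "counit p = Poly_Mapping.lookup p 0"

lemma counit_simps [simp]:
  "counit 0 = 0" "counit (p + q) = counit p + counit q" "counit (p - q) = counit p - counit q"
  "counit (free_scalar c) = c" "counit (free_gen x) = 0" "counit 1 = 1"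
  by (simp_all add: counit_def lookup_add lookup_minus free_scalar_def free_gen_def zero_word_def
      lookup_single lookup_one)

lemma counit_gen_mult: "counit (free_gen x * p) = 0"
proof -
  have "0 \<notin> Poly_Mapping.keys (free_gen x * p)"
    using keys_mult [of "free_gen x" p] by (auto simp: free_gen_def plus_word_def zero_word_def)
  then show ?thesis by (simp add: counit_def in_keys_iff)
qed

lemma counit_scalar_mult: "counit (free_scalar c * q) = c * counit q"
proof (induction q rule: free_alg_induct)
  case (scalar d)
  then show ?case by (simp flip: free_scalar_mult)
next
  case (gen x q)
  have "free_scalar c * (free_gen x * q) = free_gen x * (free_scalar c * q)"
    by (simp add: free_gen_scalar flip: mult.assoc)
  then show ?case by (simp add: counit_gen_mult)
qed (simp add: distrib_left)

lemma counit_mult [simp]: "counit (p * q) = counit p * counit q"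
  by (induction p rule: free_alg_induct)
    (simp_all add: counit_gen_mult counit_scalar_mult mult.assoc distrib_right)

lemma counit_uea_ideal:
  fixes h :: "'g :: complex_lie_algebra set"
  assumes "lie_subalgebra h" "p \<in> uea_ideal h"
  shows "counit p = 0"
proof -
  have "uea_ideal h \<subseteq> {p. counit p = 0}"
    by (rule uea_ideal_least [OF assms(1)]) (auto simp: uea_rels_def)
  then show ?thesis using assms(2) by blast
qed

lemma counit_uea_class:
  assumes "lie_subalgebra h" "q \<in> uea_class h p"
  shows "counit q = counit p"
  using assms counit_uea_ideal [OF assms(1)] by (auto simp: uea_class_def a_r_coset_def')

text \<open>By \<open>counit_uea_class\<close> all representatives give the same value.\<close>

definition aug :: "('g :: complex_lie_algebra word \<Rightarrow>\<^sub>0 complex) set \<Rightarrow> complex" where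
  "aug X = counit (SOME p. p \<in> X)"

lemma aug_class:
  assumes "lie_subalgebra h" "p \<in> carrier (free_alg h)"
  shows "aug (uea_class h p) = counit p"
  unfolding aug_def using counit_uea_class [OF assms(1)] someI [of "\<lambda>q. q \<in> uea_class h p"]
    uea_class_self [OF assms] by blast

lemma finprod_character_module:
  "finite A \<Longrightarrow> finprod (character_module \<psi>) f A = sum f A"
proof -
  interpret C: comm_monoid "character_module \<psi>"
    by (rule comm_monoidI) (simp_all add: character_module_def ac_simps)
  show "finite A \<Longrightarrow> finprod (character_module \<psi>) f A = sum f A"
  proof (induction A rule: finite_induct)
    case empty
    then show ?case by (simp only: C.finprod_empty) (simp add: character_module_def)
  next
    case (insert a A)
    then show ?case by (subst C.finprod_insert) (simp_all add: character_module_def)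
  qed
qed

text \<open>A word acts by the product of the values of \<open>\<psi>\<close> on its letters, which is zero unless the word is
  empty.\<close>

lemma free_act_zero_character:
  assumes \<psi>: "\<And>x. x \<in> h \<Longrightarrow> \<psi> x = 0" and p: "p \<in> carrier (free_alg h)"
  shows "free_act (character_module \<psi>) p v = counit p * v"
proof -
  have word: "foldr (act (character_module \<psi>)) (letters w) v = (if w = 0 then v else 0)"
    if "w \<in> Poly_Mapping.keys p" for w
  proof (cases "letters w")
    case Nil
    then have "w = 0" by (cases w) (simp add: zero_word_def)
    with Nil show ?thesis by simp
  next
    case (Cons x xs)
    then have "x \<in> h" "w \<noteq> 0" using that p by (auto simp: free_alg_carrier zero_word_def)
    with Cons show ?thesis by (simp add: character_module_def \<psi>)
  qed
  have "free_act (character_module \<psi>) p v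
      = (\<Sum>w\<in>Poly_Mapping.keys p. cmul (character_module \<psi>) (Poly_Mapping.lookup p w)
           (foldr (act (character_module \<psi>)) (letters w) v))"
    unfolding free_act_def by (simp add: finprod_character_module)
  also have "\<dots> = (\<Sum>w\<in>Poly_Mapping.keys p. Poly_Mapping.lookup p w * (if w = 0 then v else 0))"
    by (intro sum.cong refl) (simp add: word, simp add: character_module_def)
  also have "\<dots> = counit p * v"
    by (simp add: if_distrib [of "(*) _"] sum.delta' counit_def in_keys_iff cong: if_cong)
  finally show ?thesis .
qed

lemma uea_act_zero_character:
  assumes h: "lie_subalgebra h" and \<psi>: "\<And>x. x \<in> h \<Longrightarrow> \<psi> x = 0"
    and p: "p \<in> carrier (free_alg h)"
  shows "uea_act (character_module \<psi>) (uea_class h p) v = counit p * v"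
proof -
  have "q \<in> carrier (free_alg h)" if "q \<in> uea_class h p" for q
  proof -
    have "uea_ideal h \<subseteq> carrier (free_alg h)"
      using ideal_uea_ideal [OF h] by (simp add: ideal_def additive_subgroup.a_subset)
    then show ?thesis
      using that p by (auto simp: uea_class_def a_r_coset_def' intro!: free_alg_closed)
  qed
  then have "free_act (character_module \<psi>) q v = counit p * v" if "q \<in> uea_class h p" for q
    using that free_act_zero_character [of h \<psi> q v] \<psi> counit_uea_class [OF h that] by simp
  then show ?thesis
    unfolding uea_act_def using uea_class_self [OF h p] by (intro the_equality) auto
qed

lemma induction_data_character:
  "lie_subalgebra h \<Longrightarrow> induction_data h (character_module \<psi>)"
  by unfold_locales (simp_all add: character_module_def)

locale zero_character =
  fixes h :: "'g :: complex_lie_algebra set" and \<psi> :: "'g \<Rightarrow> complex"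
  assumes subalgebra: "lie_subalgebra h" and zero: "x \<in> h \<Longrightarrow> \<psi> x = 0"
begin

sublocale induction_data h "character_module \<psi>"
  by (rule induction_data_character [OF subalgebra])

abbreviation W where "W \<equiv> induced_module h (character_module \<psi>)"
abbreviation vac where "vac \<equiv> pure_tensor h (character_module \<psi>) \<one>\<^bsub>U\<^esub> 1"

lemma character_carrier [simp]: "carrier (character_module \<psi>) = UNIV"
  by (simp add: character_module_def)

sublocale W: lie_module UNIV W
  by (rule induced_lie_module)

lemma vac_closed: "vac \<in> carrier W"
  by (intro pure_tensor_closed) simp_all

text \<open>A scalar is an element of \<open>U(h)\<close>, so it can be moved across the tensor sign to act on
  the second factor.\<close>

lemma cmul_vac: "cmul W c vac = pure_tensor h (character_module \<psi>) \<one>\<^bsub>U\<^esub> c"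
proof -
  have "cmul W c vac = pure_tensor h (character_module \<psi>) (\<one>\<^bsub>U\<^esub> \<otimes>\<^bsub>U\<^esub> cl (free_scalar c)) 1"
    by (simp add: cmul_pure_tensor)
  also have "\<dots> = pure_tensor h (character_module \<psi>) \<one>\<^bsub>U\<^esub> c"
    by (subst pure_tensor_balanced)
      (simp_all add: free_alg_const_closed uea_act_zero_character [OF subalgebra zero])
  finally show ?thesis .
qed

text \<open>Here \<open>x\<close> is moved across the tensor sign, where it acts by \<open>\<psi> x = 0\<close>.\<close>

lemma act_vac:
  assumes "x \<in> h"
  shows "act W x vac = \<one>\<^bsub>W\<^esub>"
proof -
  have "act W x vac = pure_tensor h (character_module \<psi>) (\<one>\<^bsub>U\<^esub> \<otimes>\<^bsub>U\<^esub> cl (free_gen x)) 1"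
    by (simp add: act_pure_tensor)
  also have "\<dots> = pure_tensor h (character_module \<psi>) \<one>\<^bsub>U\<^esub> 0"
    by (subst pure_tensor_balanced)
      (simp_all add: assms free_alg_const_closed uea_act_zero_character [OF subalgebra zero])
  also have "\<dots> = cmul W 0 vac"
    by (simp only: cmul_vac)
  also have "\<dots> = \<one>\<^bsub>W\<^esub>"
    by (rule W.cmul_zero [OF vac_closed])
  finally show ?thesis .
qed

lemma vac_generates:
  assumes P: "lie_submodule UNIV P W" and "vac \<in> P"
  shows "P = carrier W"
  using lie_submodule.sub_cmul_closed [OF P assms(2)]
  by (intro induced_module_generated [OF P]) (simp add: cmul_vac)

text \<open>The additive map \<open>u \<otimes> b \<mapsto> \<epsilon>(u) b\<close>, with \<open>\<epsilon>\<close> the augmentation, on formal sums of pairs. Modulo the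
  tensor relations it is the homomorphism from the induced module to the trivial module that
  sends \<open>1 \<otimes> 1\<close> to 1.\<close>

definition frag_aug :: "(('g word \<Rightarrow>\<^sub>0 complex) set \<times> complex \<Rightarrow>\<^sub>0 int) \<Rightarrow> complex" where
  "frag_aug X = (\<Sum>k\<in>Poly_Mapping.keys X. of_int (Poly_Mapping.lookup X k) * (aug (fst k) * snd k))"

lemma frag_aug_superset:
  "finite A \<Longrightarrow> Poly_Mapping.keys X \<subseteq> A \<Longrightarrow>
     frag_aug X = (\<Sum>k\<in>A. of_int (Poly_Mapping.lookup X k) * (aug (fst k) * snd k))"
  unfolding frag_aug_def by (intro sum.mono_neutral_left) (auto simp: in_keys_iff)

lemma frag_aug_simps [simp]:
  "frag_aug 0 = 0" "frag_aug (frag_of (u, b)) = aug u * b"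
  "frag_aug (X - Y) = frag_aug X - frag_aug Y" "frag_aug (X + Y) = frag_aug X + frag_aug Y"
  "frag_aug (- X) = - frag_aug X"
proof -
  show "frag_aug 0 = 0" "frag_aug (frag_of (u, b)) = aug u * b"
    by (simp_all add: frag_aug_def)
  let ?A = "Poly_Mapping.keys X \<union> Poly_Mapping.keys Y"
  show "frag_aug (X - Y) = frag_aug X - frag_aug Y"
    by (simp add: frag_aug_superset [of ?A] keys_diff lookup_minus left_diff_distrib sum_subtractf)
  show "frag_aug (X + Y) = frag_aug X + frag_aug Y"
    by (simp add: frag_aug_superset [of ?A] Poly_Mapping.keys_add lookup_add distrib_right sum.distrib)
  show "frag_aug (- X) = - frag_aug X"
    by (simp add: frag_aug_def sum_negf)
qed

lemma aug_cl [simp]: "aug (cl p) = counit p"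
  by (simp add: aug_class lie_subalgebra_UNIV)

lemma aug_mult: "u \<in> carrier U \<Longrightarrow> u' \<in> carrier U \<Longrightarrow> aug (u \<otimes>\<^bsub>U\<^esub> u') = aug u * aug u'"
  by (auto simp: uea_carrier uea_class_simps)

lemma aug_add: "u \<in> carrier U \<Longrightarrow> u' \<in> carrier U \<Longrightarrow> aug (u \<oplus>\<^bsub>U\<^esub> u') = aug u + aug u'"
  by (auto simp: uea_carrier uea_class_simps)

text \<open>The map is compatible with moving \<open>r\<close> in \<open>U(h)\<close> across the tensor sign because \<open>r\<close> acts on the
  one-dimensional module by \<open>\<epsilon>(r)\<close>, the character being zero.\<close>

lemma frag_aug_K: "X \<in> K \<Longrightarrow> frag_aug X = 0"
proof -
  have rel: "frag_aug X = 0" if "X \<in> rels" for X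
    using that
  proof (cases rule: rels_cases)
    case (add_left u u' b)
    then show ?thesis by (simp add: aug_add distrib_right)
  next
    case (add_right u b b')
    then show ?thesis by (simp add: character_module_def distrib_left)
  next
    case (balanced u r b)
    then obtain p where "p \<in> carrier (free_alg h)" "r = uea_class h p"
      by (auto simp: uea_carrier)
    with balanced show ?thesis
      by (simp add: aug_mult uea_incl_class [OF subalgebra] uea_act_zero_character [OF subalgebra zero])
  qed
  show "X \<in> K \<Longrightarrow> frag_aug X = 0"
    unfolding K_eq
  proof (induction rule: generate.induct)
    case (inv X)
    then show ?case using rel [OF inv] rels_subset by (auto simp: F_inv)
  qed (use rel in auto)
qed

lemma frag_aug_lmult:
  assumes X: "X \<in> carrier F"
  shows "frag_aug (lmult (cl p) X) = counit p * frag_aug X"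
proof -
  have "Poly_Mapping.keys X \<subseteq> carrier U \<times> UNIV" using X by simp
  then show ?thesis
    by (induction X rule: frag_induction) (auto simp: aug_mult right_diff_distrib)
qed

text \<open>The submodule is the kernel of the homomorphism to the trivial module. It contains everything of the
  form \<open>x w\<close> with \<open>x\<close> in the Lie algebra, but not \<open>1 \<otimes> 1\<close>, and is what keeps submodules generated
  by such elements proper.\<close>

lemma augmentation_submodule:
  obtains J where "lie_submodule UNIV J W" "vac \<notin> J" "\<And>x w. w \<in> carrier W \<Longrightarrow> act W x w \<in> J"
proof
  define P where "P = {X \<in> carrier F. frag_aug X = 0}"
  let ?J = "(\<lambda>X. K #>\<^bsub>pre_module\<^esub> X) ` P"
  have F_zero: "0 \<in> carrier F" by (simp add: F_simps)
  have F_uminus: "- X \<in> carrier F" if "X \<in> carrier F" for X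
    using that by (simp add: F_simps)
  note [simp del] = F_simps(1)
  have "subgroup P pre_module"
    by (rule pre.subgroupI)
      (auto simp: P_def pre_inv F_add F_uminus intro!: exI [of _ 0] F_zero)
  then show "lie_submodule UNIV ?J W"
    unfolding induced_module_eq
    by (intro pre.image_submodule) (auto simp: P_def lmult_closed frag_aug_lmult)
  show "vac \<notin> ?J"
  proof
    assume "vac \<in> ?J"
    then obtain X where X: "X \<in> carrier F" "frag_aug X = 0"
      and eq: "K #>\<^bsub>pre_module\<^esub> frag_of (\<one>\<^bsub>U\<^esub>, 1) = K #>\<^bsub>pre_module\<^esub> X"
      by (auto simp: P_def pure_tensor_eq)
    have "frag_of (\<one>\<^bsub>U\<^esub>, 1) \<in> carrier F" by (simp add: F_simps)
    then have "frag_of (\<one>\<^bsub>U\<^esub>, 1) - X \<in> K"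
      using eq X by (simp add: pre.coset_eq_iff pre_inv)
    then have "aug \<one>\<^bsub>U\<^esub> = 0"
      using frag_aug_K X by fastforce
    then show False by (simp flip: uea_class_simps(3))
  qed
  show "act W x w \<in> ?J" if "w \<in> carrier W" for x w
    using that
    by (auto simp: induced_module_eq pre.quot_carrier pre.quot_act P_def lmult_closed frag_aug_lmult
        intro!: imageI)
qed

end

section \<open>Submodules of codimension one\<close>

text \<open>Closure under brackets holds because \<open>[x, y] v = x (y v) - y (x v)\<close>. This turns the question
  which submodule an element generates into one about generators of the Lie algebra.\<close>

lemma lie_subalgebra_transporter:
  assumes N: "lie_submodule UNIV N M" and v: "v \<in> carrier M"
  shows "lie_subalgebra {x. act M x v \<in> N}"
proof -
  interpret lie_submodule UNIV N M by (rule N)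
  have "act M 0 v = \<one>\<^bsub>M\<^esub>"
    using act_cscale [of 0 v 0] v cmul_zero [of "act M 0 v"] by (simp add: act_closed)
  then show ?thesis
    using v by (auto simp: lie_subalgebra_def clie.subspace_def act_add_left act_cscale act_bracket
        intro!: m_closed m_inv_closed sub_cmul_closed sub_act_closed)
qed

text \<open>As the Lie algebra maps both \<open>V\<close> and \<open>v\<close> into \<open>V\<close>, the sum of \<open>V\<close> and the line through \<open>v\<close> is a
  submodule. It contains the generator \<open>v\<close>, so it is the whole of \<open>M\<close>. Hence the quotient is the
  line through the class of \<open>v\<close>, and the Lie algebra acts on it by zero; and a submodule larger than
  \<open>V\<close> contains a nonzero multiple of \<open>v\<close>.\<close>

lemma codimension_one_submodule:
  fixes M :: "('g :: complex_lie_algebra, 'v) lie_mod" (structure)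
  assumes V: "lie_submodule UNIV V M" and v: "v \<in> carrier M" "v \<notin> V"
    and act_v: "\<And>x. act M x v \<in> V"
    and gen: "\<And>P. lie_submodule UNIV P M \<Longrightarrow> v \<in> P \<Longrightarrow> P = carrier M"
  shows "maximal_proper_submodule UNIV M V \<and> one_dimensional_module UNIV (quot_module M V) \<and>
    trivial_module UNIV (quot_module M V)"
proof -
  interpret V: lie_submodule UNIV V M by (rule V)
  interpret Q: lie_module_modulo V M by (rule lie_submodule_imp_modulo [OF V])
  interpret quot: lie_module UNIV "quot_module M V" by (rule Q.quot_lie_module)
  define S where "S = {u \<otimes> cmul M c v | u c. u \<in> V}"
  have cv: "cmul M c v \<in> carrier M" for c
    using v by (simp add: V.cmul_closed)
  have SI: "u \<otimes> cmul M c v \<in> S" if "u \<in> V" for u c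
    using that by (auto simp: S_def)
  have cv0: "cmul M 0 v = \<one>" using v by (simp add: V.cmul_zero)
  have V_S: "u \<in> S" if "u \<in> V" for u
    using SI [OF that, of 0] that by (simp add: cv0)
  have inv_cv: "inv (cmul M c v) = cmul M (- c) v" for c
    using V.cmul_add_left [of v "- c" c] v by (intro V.inv_equality) (simp_all add: cv cv0)
  have act_S: "act M x w \<in> V" if "w \<in> S" for x w
  proof -
    obtain u c where w: "w = u \<otimes> cmul M c v" and u: "u \<in> V" using \<open>w \<in> S\<close> by (auto simp: S_def)
    have "act M x w = act M x u \<otimes> cmul M c (act M x v)"
      unfolding w using u v by (simp add: V.act_add_right V.act_cmul cv)
    then show ?thesis using u act_v by (simp add: V.sub_act_closed V.sub_cmul_closed)
  qed
  have "subgroup S M"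
  proof (rule V.subgroupI)
    show "S \<subseteq> carrier M" using cv by (auto simp: S_def)
    show "S \<noteq> {}" using V_S [OF V.one_closed] by auto
    show "inv w \<in> S" if "w \<in> S" for w
    proof -
      obtain u c where w: "w = u \<otimes> cmul M c v" and u: "u \<in> V" using \<open>w \<in> S\<close> by (auto simp: S_def)
      have "inv w = inv u \<otimes> cmul M (- c) v"
        unfolding w using u by (simp add: V.inv_mult cv inv_cv)
      then show ?thesis using SI u by simp
    qed
    show "w \<otimes> w' \<in> S" if "w \<in> S" "w' \<in> S" for w w'
    proof -
      obtain u c where w: "w = u \<otimes> cmul M c v" and u: "u \<in> V" using \<open>w \<in> S\<close> by (auto simp: S_def)
      obtain u' c' where w': "w' = u' \<otimes> cmul M c' v" and u': "u' \<in> V"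
        using \<open>w' \<in> S\<close> by (auto simp: S_def)
      have "w \<otimes> w' = (u \<otimes> u') \<otimes> cmul M (c + c') v"
        unfolding w w' using u u' v by (simp add: V.cmul_add_left cv V.m_ac)
      then show ?thesis using SI u u' by simp
    qed
  qed
  moreover have "cmul M d w \<in> S" if "w \<in> S" for d w
  proof -
    obtain u c where w: "w = u \<otimes> cmul M c v" and u: "u \<in> V" using \<open>w \<in> S\<close> by (auto simp: S_def)
    have "cmul M d w = cmul M d u \<otimes> cmul M (d * c) v"
      unfolding w using u v by (simp add: V.cmul_add_right V.cmul_cmul cv)
    then show ?thesis using SI u by (simp add: V.sub_cmul_closed)
  qed
  ultimately have "lie_submodule UNIV S M"
    using act_S V_S by (simp add: lie_submodule_def lie_submodule_axioms_def V.lie_module_axioms)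
  moreover have "v \<in> S"
    using SI [OF V.one_closed, of 1] v by (simp add: V.cmul_one)
  ultimately have S: "S = carrier M" by (rule gen)
  have dec: "\<exists>u c. u \<in> V \<and> w = u \<otimes> cmul M c v" if "w \<in> carrier M" for w
    using that unfolding S [symmetric] S_def by blast
  have "N = carrier M" if N: "lie_submodule UNIV N M" and VN: "V \<subseteq> N" and "N \<noteq> V" for N
  proof -
    interpret N: lie_submodule UNIV N M by (rule N)
    obtain n where n: "n \<in> N" "n \<notin> V" using VN \<open>N \<noteq> V\<close> by auto
    then obtain u c where w: "n = u \<otimes> cmul M c v" and u: "u \<in> V"
      using dec [of n] by auto
    have "c \<noteq> 0" using n u by (auto simp: w cv0)
    have "cmul M c v = inv u \<otimes> n"
      using u by (simp add: w V.m_assoc [symmetric] cv)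
    then have "cmul M c v \<in> N" using u n VN by auto
    then have "cmul M (1 / c) (cmul M c v) \<in> N" by (rule N.sub_cmul_closed)
    then have "v \<in> N" using v \<open>c \<noteq> 0\<close> by (simp add: V.cmul_cmul V.cmul_one)
    then show ?thesis by (rule gen [OF N])
  qed
  then have "maximal_proper_submodule UNIV M V"
    using v V by (auto simp: maximal_proper_submodule_def)
  moreover have "one_dimensional_module UNIV (quot_module M V)"
  proof -
    have coset: "V #> (u \<otimes> cmul M c v) = cmul (quot_module M V) c (V #> v)" if "u \<in> V" for u c
    proof -
      have "V #> (u \<otimes> cmul M c v) = V #> cmul M c v"
        using that cv by (simp add: Q.coset_eq_iff V.m_assoc)
      then show ?thesis using v by (simp add: Q.quot_cmul)
    qed
    have "carrier (quot_module M V) = range (\<lambda>c. cmul (quot_module M V) c (V #> v))"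
    proof
      show "carrier (quot_module M V) \<subseteq> range (\<lambda>c. cmul (quot_module M V) c (V #> v))"
        using dec coset by (force simp: Q.quot_carrier)
      show "range (\<lambda>c. cmul (quot_module M V) c (V #> v)) \<subseteq> carrier (quot_module M V)"
        using v cv by (auto simp: Q.quot_carrier Q.quot_cmul)
    qed
    moreover have "V #> v \<in> carrier (quot_module M V)" "V #> v \<noteq> \<one>\<^bsub>quot_module M V\<^esub>"
      using v by (simp_all add: Q.quot_carrier Q.quot_one Q.coset_eq_one_iff)
    ultimately show ?thesis
      unfolding one_dimensional_module_def using quot.lie_module_axioms by blast
  qed
  moreover have "trivial_module UNIV (quot_module M V)"
    using quot.lie_module_axioms act_S
    by (auto simp: trivial_module_def Q.quot_carrier Q.quot_act Q.quot_one Q.coset_eq_one_iff S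
        V.act_closed)
  ultimately show ?thesis by blast
qed

text \<open>Since \<open>z\<close> is central, \<open>w \<mapsto> z w + c w\<close> is an endomorphism of the module, so its image is a
  submodule.\<close>

lemma central_image_submodule:
  fixes M :: "('g :: complex_lie_algebra, 'v) lie_mod" (structure)
  assumes M: "lie_module UNIV M" and z: "\<And>x. lie_bracket x z = 0"
  shows "lie_submodule UNIV ((\<lambda>w. act M z w \<otimes> cmul M c w) ` carrier M) M"
proof -
  interpret lie_module UNIV M by (rule M)
  let ?f = "\<lambda>w. act M z w \<otimes> cmul M c w"
  have "act M 0 w = \<one>" if "w \<in> carrier M" for w
    using act_cscale [of 0 w 0] that cmul_zero [of "act M 0 w"] by (simp add: act_closed)
  then have comm: "act M x (act M z w) = act M z (act M x w)" if "w \<in> carrier M" for x w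
  proof -
    have "act M x (act M z w) \<otimes> inv (act M z (act M x w)) = \<one>"
      using act_bracket [of x z w] that \<open>\<And>w. w \<in> carrier M \<Longrightarrow> act M 0 w = \<one>\<close> by (simp add: z)
    then have "act M x (act M z w) \<otimes> inv (act M z (act M x w)) \<otimes> act M z (act M x w)
        = act M z (act M x w)"
      using that by (simp add: act_closed)
    then show ?thesis using that by (simp add: act_closed m_assoc)
  qed
  have f: "?f \<in> hom M M"
    by (auto simp: hom_def act_closed cmul_closed act_add_right cmul_add_right m_ac)
  interpret f: group_hom M M ?f
    by (simp add: group_hom_def group_hom_axioms_def f)
  have "subgroup (?f ` carrier M) M" by (rule f.img_is_subgroup)
  moreover have "cmul M d v \<in> ?f ` carrier M" if v: "v \<in> ?f ` carrier M" for d v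
  proof -
    obtain w where w: "v = ?f w" "w \<in> carrier M" using v by (rule imageE)
    then have "cmul M d v = ?f (cmul M d w)"
      by (simp add: cmul_add_right act_closed cmul_closed act_cmul cmul_cmul mult.commute)
    then show ?thesis by (rule image_eqI) (simp add: w cmul_closed)
  qed
  moreover have "act M x v \<in> ?f ` carrier M" if v: "v \<in> ?f ` carrier M" for x v
  proof -
    obtain w where w: "v = ?f w" "w \<in> carrier M" using v by (rule imageE)
    then have "act M x v = ?f (act M x w)"
      by (simp add: act_add_right act_closed cmul_closed act_cmul comm)
    then show ?thesis by (rule image_eqI) (simp add: w act_closed)
  qed
  ultimately show ?thesis
    by (simp add: lie_submodule_def lie_submodule_axioms_def M)
qed

section \<open>The Schroedinger-Virasoro algebra\<close>

lemma lie_bracket_swap: "lie_bracket x y = - lie_bracket y (x :: 'g :: complex_lie_algebra)"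
proof -
  have "lie_bracket x y + lie_bracket y x = lie_bracket (x + y) (x + y)"
    unfolding bracket_add_left bracket_add_right by (simp add: bracket_self)
  then show ?thesis by (simp add: bracket_self eq_neg_iff_add_eq_0)
qed

lemma subspace_bracket_left:
  "clie.subspace S \<Longrightarrow> clie.subspace {y. lie_bracket (x :: 'g :: complex_lie_algebra) y \<in> S}"
  using bracket_add_right [of x 0 0]
  by (auto simp: clie.subspace_def bracket_add_right bracket_cscale_right)

lemma subspace_bracket_right:
  "clie.subspace S \<Longrightarrow> clie.subspace {x. lie_bracket x (y :: 'g :: complex_lie_algebra) \<in> S}"
  using bracket_add_left [of 0 0 y]
  by (auto simp: clie.subspace_def bracket_add_left bracket_cscale_left)

lemma sv_subspace_UNIV:
  assumes S: "clie.subspace S" and basis: "\<And>i. sv_basis i \<in> S"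
  shows "S = UNIV"
proof -
  have "of_coords p \<in> S" for p
  proof (induction p rule: pm_induct)
    case 1
    then show ?case
      using clie.subspace_0 [OF S] by (simp add: zero_sv_def)
  next
    case (2 i c)
    have "of_coords (Poly_Mapping.single i c) = cscale c (sv_basis i)"
      by (simp add: cscale_sv_def sv_basis_def of_coords_inverse pm_scale_simps)
    then show ?case using clie.subspace_scale [OF S basis] by simp
  next
    case (3 p q)
    have "of_coords (p + q) = of_coords p + of_coords q"
      by (simp add: plus_sv_def of_coords_inverse)
    then show ?case using clie.subspace_add [OF S 3] by simp
  qed
  then show ?thesis by (metis UNIV_eq_I coords_inverse)
qed

lemma sv_M0_central: "lie_bracket x (sv_M 0) = 0"
proof -
  have "clie.subspace {x. lie_bracket x (sv_M 0) = 0}"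
    using subspace_bracket_right [of "{0}" "sv_M 0"] clie.subspace_single_0 by simp
  moreover have "lie_bracket (sv_basis i) (sv_M 0) = 0" for i
    by (cases i) (simp_all add: sv_brackets lie_bracket_swap [of "sv_Y _" "sv_M 0"])
  ultimately show ?thesis using sv_subspace_UNIV by blast
qed

lemma sv_plus_basis:
  "n \<ge> 1 \<Longrightarrow> sv_L n \<in> sv_plus" "n \<ge> 1 \<Longrightarrow> sv_M n \<in> sv_plus" "n \<ge> 0 \<Longrightarrow> sv_Y n \<in> sv_plus"
  unfolding sv_plus_def by (auto intro!: clie.span_base)

lemma lie_subalgebra_sv_plus: "lie_subalgebra sv_plus"
proof -
  let ?B = "{sv_L n | n. n \<ge> 1} \<union> {sv_M n | n. n \<ge> 1} \<union> {sv_Y m | m. m \<ge> 0}"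
  have sub: "clie.subspace sv_plus" by (simp add: sv_plus_def)
  have swap: "lie_bracket y x \<in> sv_plus" if "lie_bracket x y \<in> sv_plus" for x y
    using clie.subspace_neg [OF sub that] by (simp flip: lie_bracket_swap)
  have scale: "cscale c b \<in> sv_plus" if "b \<in> sv_plus" for c b
    by (rule clie.subspace_scale [OF sub that])
  have zero: "0 \<in> sv_plus" by (rule clie.subspace_0 [OF sub])
  have LL: "lie_bracket (sv_L m) (sv_L n) \<in> sv_plus" if "m \<ge> 1" "n \<ge> 1" for m n
    using that by (simp add: sv_brackets scale sv_plus_basis)
  have LM: "lie_bracket (sv_L m) (sv_M n) \<in> sv_plus" if "m \<ge> 1" "n \<ge> 1" for m n
    using that by (simp add: sv_brackets scale sv_plus_basis)
  have LY: "lie_bracket (sv_L m) (sv_Y n) \<in> sv_plus" if "m \<ge> 1" "n \<ge> 0" for m n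
    using that by (simp add: sv_brackets scale sv_plus_basis)
  have YY: "lie_bracket (sv_Y m) (sv_Y n) \<in> sv_plus" if "m \<ge> 0" "n \<ge> 0" for m n
    using that by (simp add: sv_brackets scale sv_plus_basis)
  have M: "lie_bracket (sv_M m) (sv_M n) \<in> sv_plus" "lie_bracket (sv_M m) (sv_Y n) \<in> sv_plus" for m n
    by (simp_all add: sv_brackets zero)
  have 1: "lie_bracket b b' \<in> sv_plus" if "b \<in> ?B" "b' \<in> ?B" for b b'
    using that
    by (elim UnE CollectE exE conjE; hypsubst)
      (assumption | rule LL LM LY YY M | rule swap, rule LM LY M)+
  have 2: "lie_bracket b y \<in> sv_plus" if "b \<in> ?B" "y \<in> sv_plus" for b y
  proof -
    have "sv_plus \<subseteq> {y. lie_bracket b y \<in> sv_plus}"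
      using 1 [OF that(1)] subspace_bracket_left [OF sub, of b]
      by (subst sv_plus_def) (intro clie.span_minimal; blast)
    then show ?thesis using that(2) by blast
  qed
  have "lie_bracket x y \<in> sv_plus" if "x \<in> sv_plus" "y \<in> sv_plus" for x y
  proof -
    have "sv_plus \<subseteq> {x. lie_bracket x y \<in> sv_plus}"
      using 2 [OF _ that(2)] subspace_bracket_right [OF sub, of y]
      by (subst sv_plus_def) (intro clie.span_minimal; blast)
    then show ?thesis using that(1) by blast
  qed
  then show ?thesis using sub by (simp add: lie_subalgebra_def)
qed

text \<open>From \<open>L\<^sub>-\<^sub>2\<close> one gets \<open>L\<^sub>-\<^sub>1\<close> and \<open>L\<^sub>0\<close> by brackets with \<open>L\<^sub>1\<close>, then all remaining \<open>L\<^sub>n\<close> with negative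
  \<open>n\<close> by brackets with \<open>L\<^sub>-\<^sub>1\<close>. Brackets with the \<open>L\<^sub>n\<close> move \<open>M\<^sub>1\<close> and \<open>sv_Y 0\<close> to
  every other index, up to nonzero factors with one exception, which lies in \<open>sv_plus\<close>.\<close>

lemma sv_generated:
  assumes A: "lie_subalgebra A" and plus: "sv_plus \<subseteq> A" and L2: "sv_L (- 2) \<in> A"
  shows "A = UNIV"
proof -
  have sub: "clie.subspace A" using A by (simp add: lie_subalgebra_def)
  have bracket: "lie_bracket x y \<in> A" if "x \<in> A" "y \<in> A" for x y
    using A that by (simp add: lie_subalgebra_def)
  have unscale: "b \<in> A" if "cscale c b \<in> A" "c \<noteq> 0" for c b
    using clie.subspace_scale [OF sub that(1), of "inverse c"] that(2)
    by (simp add: cscale_cscale cscale_one)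
  have plus_L: "sv_L n \<in> A" if "n \<ge> 1" for n using that plus sv_plus_basis by blast
  have M1: "sv_M 1 \<in> A" using plus sv_plus_basis(2) [of 1] by auto
  have plus_Y: "sv_Y n \<in> A" if "n \<ge> 0" for n using that plus sv_plus_basis by blast
  have "cscale (- 3) (sv_L (- 1)) \<in> A"
    using bracket [OF plus_L [of 1] L2] by (simp add: sv_brackets)
  then have L1: "sv_L (- 1) \<in> A" by (rule unscale) simp
  have "cscale (- 2) (sv_L 0) \<in> A"
    using bracket [OF plus_L [of 1] L1] by (simp add: sv_brackets)
  then have L0: "sv_L 0 \<in> A" by (rule unscale) simp
  \<comment> \<open>The induction starts at \<open>-2\<close>: the bracket of \<open>L\<^sub>-\<^sub>1\<close> with itself is zero.\<close>
  have neg: "sv_L (- int n - 2) \<in> A" for n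
  proof (induction n)
    case 0
    then show ?case using L2 by simp
  next
    case (Suc n)
    have "cscale (of_int (- int n - 1)) (sv_L (- int (Suc n) - 2)) \<in> A"
    proof -
      have "- int n - 2 - (- 1) = - int n - 1" "- 1 + (- int n - 2) = - int (Suc n) - 2" by simp_all
      then show ?thesis using bracket [OF L1 Suc] by (simp only: sv_brackets)
    qed
    moreover have "complex_of_int (- int n - 1) \<noteq> 0"
      unfolding of_int_eq_0_iff by linarith
    ultimately show ?case by (rule unscale)
  qed
  have L: "sv_L m \<in> A" for m
  proof -
    consider "m \<ge> 1" | "m = 0" | "m = - 1" | "m \<le> - 2" by linarith
    then show ?thesis
    proof cases
      case 4
      then show ?thesis using neg [of "nat (- m - 2)"] by simp
    qed (simp_all add: L0 L1 plus_L)
  qed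
  have M: "sv_M m \<in> A" for m
    using bracket [OF L [of "m - 1"] M1] by (simp add: sv_brackets cscale_one)
  have Y: "sv_Y m \<in> A" for m
  proof (cases "m = 1")
    case True
    then show ?thesis by (simp add: plus_Y)
  next
    case False
    \<comment> \<open>The factor vanishes exactly for the index that the other case treats.\<close>
    have "cscale ((1 - of_int m) / 2) (sv_Y m) \<in> A"
      using bracket [OF L [of m] plus_Y [of 0]] by (simp add: sv_brackets)
    then show ?thesis by (rule unscale) (use False in simp)
  qed
  have "sv_basis i \<in> A" for i
    by (cases i) (simp_all add: L M Y)
  then show ?thesis by (rule sv_subspace_UNIV [OF sub])
qed

theorem proposition5p8:
  fixes \<psi> :: "sv \<Rightarrow> complex" and \<xi> :: complex and V :: "w_space set set"
  assumes "lie_character sv_plus \<psi>"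
    and "\<forall>x\<in>sv_plus. \<psi> x = 0"
    and "\<xi> = 0"
    and "V = gen_submodule UNIV (L_mod \<psi> \<xi>) {act (L_mod \<psi> \<xi>) (sv_L (-2)) (w_bar \<psi> \<xi>)}"
  shows "maximal_proper_submodule UNIV (L_mod \<psi> \<xi>) V \<and>
    one_dimensional_module UNIV (quot_module (L_mod \<psi> \<xi>) V) \<and>
    trivial_module UNIV (quot_module (L_mod \<psi> \<xi>) V)"
proof -
  interpret zero_character sv_plus \<psi>
    using lie_subalgebra_sv_plus assms(2) by unfold_locales auto
  let ?R = "M0_image \<psi> \<xi>" and ?L = "L_mod \<psi> \<xi>" and ?w = "w_bar \<psi> \<xi>"
  have W: "W_mod \<psi> = W" by (simp add: W_mod_def)
  have R: "lie_submodule UNIV ?R W"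
    unfolding M0_image_def W by (rule central_image_submodule [OF induced_lie_module sv_M0_central])
  interpret R: lie_module_modulo ?R W by (rule lie_submodule_imp_modulo [OF R])
  have L: "?L = quot_module W ?R" by (simp add: L_mod_def W)
  have w: "?w = ?R #>\<^bsub>W\<^esub> vac" by (simp add: w_bar_def W)
  interpret L: lie_module UNIV ?L unfolding L by (rule R.quot_lie_module)
  have w_closed: "?w \<in> carrier ?L"
    by (simp add: w L R.quot_carrier vac_closed)
  have V: "lie_submodule UNIV V ?L"
    unfolding assms(4) using w_closed by (intro lie_submodule_gen_submodule L.lie_module_axioms)
      (simp add: L.act_closed)
  have L2: "act ?L (sv_L (- 2)) ?w \<in> V"
    unfolding assms(4) by (rule subsetD [OF gen_submodule_superset]) simp
  have "{x. act ?L x ?w \<in> V} = UNIV"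
  proof (rule sv_generated)
    show "lie_subalgebra {x. act ?L x ?w \<in> V}"
      using lie_subalgebra_transporter [OF V w_closed] .
    have "act ?L x ?w = \<one>\<^bsub>?L\<^esub>" if "x \<in> sv_plus" for x
      using act_vac [OF that] vac_closed R.coset_eq_one_iff [of "\<one>\<^bsub>W\<^esub>"]
      by (simp add: w L R.quot_act R.quot_one)
    then show "sv_plus \<subseteq> {x. act ?L x ?w \<in> V}"
      using subgroup.one_closed [OF lie_submodule.axioms(2) [OF V]] by auto
  qed (use L2 in simp)
  then have act_w: "act ?L x ?w \<in> V" for x by blast
  have gen: "P = carrier ?L" if P: "lie_submodule UNIV P ?L" and "?w \<in> P" for P
  proof -
    have "lie_submodule UNIV {v \<in> carrier W. ?R #>\<^bsub>W\<^esub> v \<in> P} W"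
      using preimage_submodule [OF R] P by (simp add: L)
    moreover have "vac \<in> {v \<in> carrier W. ?R #>\<^bsub>W\<^esub> v \<in> P}"
      using \<open>?w \<in> P\<close> vac_closed by (simp add: w)
    ultimately have "{v \<in> carrier W. ?R #>\<^bsub>W\<^esub> v \<in> P} = carrier W"
      by (rule vac_generates)
    then have "carrier ?L \<subseteq> P" by (auto simp: L R.quot_carrier)
    then show ?thesis using subgroup.subset [OF lie_submodule.axioms(2) [OF P]] by blast
  qed
  have "?w \<notin> V"
  proof
    assume "?w \<in> V"
    obtain J where J: "lie_submodule UNIV J W" "vac \<notin> J" and act_J: "\<And>x v. v \<in> carrier W \<Longrightarrow> act W x v \<in> J"
      by (rule augmentation_submodule) blast
    interpret J: lie_submodule UNIV J W by (rule J)
    \<comment> \<open>The kernel of the augmentation contains the image of \<open>M\<^sub>0\<close>, so it descends to a submodule of the quotient, which contains \<open>V\<close> but not the generator.\<close>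
    let ?J = "(\<lambda>v. ?R #>\<^bsub>W\<^esub> v) ` J"
    have "lie_submodule UNIV ?J ?L"
      unfolding L by (intro R.image_submodule J.subgroup_axioms J.sub_cmul_closed J.sub_act_closed) simp_all
    moreover have "act ?L (sv_L (- 2)) ?w \<in> ?J"
      using act_J vac_closed by (simp add: w L R.quot_act)
    ultimately have "V \<subseteq> ?J" unfolding assms(4) by (intro gen_submodule_least) auto
    then obtain j where j: "j \<in> J" "?R #>\<^bsub>W\<^esub> vac = ?R #>\<^bsub>W\<^esub> j"
      using \<open>?w \<in> V\<close> by (auto simp: w)
    then have "vac \<otimes>\<^bsub>W\<^esub> inv\<^bsub>W\<^esub> j \<in> ?R"
      using vac_closed by (simp add: R.coset_eq_iff)
    moreover have "?R \<subseteq> J"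
    proof
      fix v assume "v \<in> ?R"
      then obtain w where "v = act W (sv_M 0) w \<otimes>\<^bsub>W\<^esub> cmul W (- \<xi>) w" "w \<in> carrier W"
        unfolding M0_image_def W by (rule imageE)
      then show "v \<in> J"
        by (simp add: assms(3) W.cmul_zero W.act_closed act_J)
    qed
    ultimately have "vac \<otimes>\<^bsub>W\<^esub> inv\<^bsub>W\<^esub> j \<in> J" by (rule rev_subsetD)
    then have "(vac \<otimes>\<^bsub>W\<^esub> inv\<^bsub>W\<^esub> j) \<otimes>\<^bsub>W\<^esub> j \<in> J"
      using j(1) by (rule J.m_closed)
    moreover have "(vac \<otimes>\<^bsub>W\<^esub> inv\<^bsub>W\<^esub> j) \<otimes>\<^bsub>W\<^esub> j = vac"
      using j(1) vac_closed by (simp add: W.m_assoc)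
    ultimately show False using J(2) by simp
  qed
  then show ?thesis
    by (rule codimension_one_submodule [OF V w_closed _ act_w gen])
qed

end
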